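(* The processor $\mathit{Proc}_{\mathtt{subcrit}}$ that maps a DP problem $(\mathcal P_1\uplus\mathcal P_2,\mathcal R,m,f)$ with $m\succeq\mathtt{minimal}$ to $\{(\mathcal P_2,\mathcal R,m,f)\}$ if there exists a projection function $\nu$ for $\mathcal P_1\uplus\mathcal P_2$ such that $\overline\nu(\ell)\rhd\overline\nu(p)$ for all $\ell\Rrightarrow p\ (A)\in\mathcal P_1$ and $\overline\nu(\ell)=\overline\nu(p)$ for all $\ell\Rrightarrow p\ (A)\in\mathcal P_2$ (and maps every other DP problem $N$ to $\{N\}$) is sound and complete.
   Context: Basic notions (higher-order rewriting with meta-variables). Types are built from sorts by $\to$. There are disjoint sets of function symbols, variables $\mathcal V$ and meta-variables (each typed; meta-variables $Z$ have an arity; infinitely many variables and meta-variables of each type). Meta-terms are built from variables, function symbols, application $s\,t$, abstraction $\lambda x.s$ and meta-variable applications $Z\langle s_1,..,s_k\rangle$ ($k=\mathit{arity}(Z)$), all well-typed; terms are meta-terms without meta-variables; modulo $\alpha$; $FV,FMV$ = free variables, meta-variables; closed = no free variables. Subterms: $s\unrhd t$ iff $s=t$ or $s\rhd t$, where $\lambda x.s'\rhd t$ if $s'\unrhd t$ and $s_1s_2\rhd t$ if $s_1\unrhd t$ or $s_2\unrhd t$. A pattern is $Z\langle x_1..x_k\rangle$ (distinct variables), $\lambda x.\ell$, or $a\,\ell_1\cdots\ell_n$ with $a$ a function symbol or variable. Substitutions map variables/meta-variables to (meta-)terms; $Z\langle s_1..s_k\rangle\gamma=u[x_1:=s_1\gamma..x_n:=s_n\gamma](s_{n+1}\gamma)\cdots(s_k\gamma)$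 if $\gamma(Z)=\lambda x_1..x_n.u$ ($n=k$, or $n<k$ and $u$ not an abstraction), otherwise substitution is homomorphic and capture-avoiding. A rule is $\ell\Rightarrow r$ with $\ell,r$ closed meta-terms of the same type, $\ell$ a pattern $\mathsf f\,\ell_1\cdots\ell_n$, $FMV(r)\subseteq FMV(\ell)$. $\to_{\mathcal R}$ is the closure under all contexts of $\ell\delta\to r\delta$ ($\ell\Rightarrow r\in\mathcal R$, $\mathrm{dom}(\delta)=FMV(\ell)$) and $\beta$: $(\lambda x.s)t\to s[x:=t]$. The signature used for terms contains marked symbols $\mathsf f^\sharp$, and for each type countably many symbols not used in the rules. Dependency pairs: a DP is a triple $\ell\Rrightarrow p\ (A)$ with $\ell$ a closed pattern $\mathsf f\,\ell_1\cdots\ell_k$, $p$ a closed meta-term $\mathsf g\,p_1\cdots p_n$, $A$ a set of conditions $Z:i$; conservative if $FMV(p)\subseteq FMV(\ell)$. $\gamma$ respects $A$ if for all $Z:i\in A$, $\gamma(Z)=\lambda x_1..x_j.t$ with $i>j$ or ($i\le j$ and $x_i\in FV(t)$). $s\trianglerighteq^\beta_A t$: $s=t$; or $s=\lambda x.u$, $u\trianglerighteq^\beta_A t$; or $s=(\lambda x.u)s_0\cdots s_n$ and some $s_i\trianglerighteq^\beta_At$ or $u[x:=s_0]s_1\cdots s_n\trianglerighteq^\beta_At$; or $s=a\,s_1\cdots s_n$ ($a$ function symbol or variable) and some $s_i\trianglerighteq^\beta_At$; or $s=Z\langle t_1..t_e\rangle s_1\cdots s_n$ and some $s_i\trianglerighteq^\beta_At$,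 or some $t_i\trianglerighteq^\beta_At$ with $(Z:i)\in A$. Chains: a $(\mathcal P,\mathcal R)$-chain is a finite or infinite sequence $[(\ell_0\Rrightarrow p_0(A_0),s_0,t_0),\dots]$ of DPs in $\mathcal P$ and terms such that for all $i$ some substitution $\gamma_i$ on domain $FMV(\ell_i)\cup FMV(p_i)$ respecting $A_i$ has $s_i=\ell_i\gamma_i,t_i=p_i\gamma_i$, and $t_i=\mathsf f\,u_1\cdots u_n$, $s_{i+1}=\mathsf f\,w_1\cdots w_n$ with $u_j\to^*_{\mathcal R}w_j$. Minimal: strict subterms of all $t_i$ are $\to_{\mathcal R}$-terminating. Computable: fix a sort quasi-ordering with well-founded strict part; $\iota\succeq_+\sigma_1\to..\to\sigma_m\to\kappa$ iff $\iota\succeq\kappa$ and $\iota\succ_-\sigma_i$ for all $i$; $\iota\succ_-\sigma$ iff $\iota\succ\kappa$ and $\iota\succeq_+\sigma_i$ for all $i$; $\mathit{Acc}(\mathsf f)=\{i\mid\iota\succeq_+\sigma_i\}$ for $\mathsf f:\sigma_1\to..\to\sigma_m\to\iota$. For rules $\mathcal U$, an RC-set is a set $I$ of base-type terms, all $\to_{\mathcal U}$-terminating, closed under $\to_{\mathcal U}$, containing each $x\,s_1..s_n$ ($x\in\mathcal V$) or $(\lambda x.u)s_0..s_n$ whose reducts all lie in $I$; $I$-computable: base-type terms in $I$, and $s:\sigma\to\tau$ with $s\,t$ $I$-computable for all $I$-computable $t$. $\mathsf f\,s_1..s_m\rightsquigarrow_I s_i\,t_1..t_n$ if both sides have base type,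 $i\in\mathit{Acc}(\mathsf f)$, all $t_j$ $I$-computable. $C_{\mathcal U}$ is an RC-set with $C_{\mathcal U}=\{s$ base type, terminating under $\to_{\mathcal U}\cup\rightsquigarrow_{C_{\mathcal U}}$, with $s\to^*_{\mathcal U}\mathsf f\,s_1..s_m$ implying $s_i$ $C_{\mathcal U}$-computable for $i\in\mathit{Acc}(\mathsf f)\}$. A chain is $\mathcal U$-computable if $\to_{\mathcal U}\supseteq\to_{\mathcal R}$ and for all $i$, $(\lambda x_1..x_n.v)\gamma_i$ is $C_{\mathcal U}$-computable whenever $p_i\trianglerighteq^\beta_Bv$, $\gamma_i$ respects $B$, $FV(v)=\{x_1..x_n\}$. Formative: a reduction $s\to^*_{\mathcal R}\ell\gamma$ is $\ell$-formative if inductively: $\ell$ is not fully extended linear (a meta-variable occurs twice, or $\ell$ has a sub-meta-term $\lambda x.C[Z\langle\vec s\rangle]$ with $x\notin\vec s$); or $\ell=Z\langle\vec x\rangle$ and $s=\ell\gamma$; or $s=a\,s_1..s_n$, $\ell=a\,\ell_1..\ell_n$ ($a$ a (marked) function symbol or variable) with $s_i\to^*\ell_i\gamma$ $\ell_i$-formative; or $s=\lambda x.s'$, $\ell=\lambda x.\ell'$, $s'\to^*\ell'\gamma$ $\ell'$-formative; or $s=(\lambda x.u)v\,w_1..w_n$ and $u[x:=v]w_1..w_n\to^*\ell\gamma$ $\ell$-formative; or $\ell$ is not a meta-variable application and there are a rule $\ell'\Rightarrow r'$, meta-variables $Z_1..Z_n$, $\delta$ with $s\to^*(\ell'Z_1..Z_n)\delta$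 $(\ell'Z_1..Z_n)$-formative and $(r'Z_1..Z_n)\delta\to^*\ell\gamma$ $\ell$-formative. A chain is formative if each $t_i\to^*_{\mathcal R}s_{i+1}$ is $\ell_{i+1}$-formative. DP problems: $(\mathcal P,\mathcal R,m,f)$ with $m\in\{\mathtt{minimal},\mathtt{arbitrary}\}\cup\{\mathtt{computable}_{\mathcal U}\mid\mathcal U$ a set of rules$\}$, $f\in\{\mathtt{formative},\mathtt{all}\}$. $\succeq$ on flags is the reflexive-transitive relation generated by $\mathtt{computable}_{\mathcal U}\succeq\mathtt{minimal}\succeq\mathtt{arbitrary}$. Finite: no infinite $(\mathcal P,\mathcal R)$-chain that is $\mathcal U$-computable if $m=\mathtt{computable}_{\mathcal U}$, minimal if $m=\mathtt{minimal}$, formative if $f=\mathtt{formative}$. Infinite: $\to_{\mathcal R}$ non-terminating or an infinite $(\mathcal P,\mathcal R)$-chain with only conservative DPs exists. A processor maps a DP problem to NO or a set of DP problems; sound if $M$ is finite whenever $\mathit{Proc}(M)\ne$ NO and all its elements are finite; complete if $M$ is infinite whenever $\mathit{Proc}(M)=$ NO or contains an infinite element. Projection functions: for a set $\mathcal P$ of DPs, $\mathtt{heads}(\mathcal P)$ is the set of symbols occurring as head of a left- or right-hand side of a DP in $\mathcal P$. A projection function for $\mathcal P$ is $\nu:\mathtt{heads}(\mathcal P)\to\mathbb N$ such that for all $\ell\Rrightarrow p\ (A)\in\mathcal P$ the map $\overline\nu(\mathsf f\,s_1\cdots s_n)=s_{\nu(\mathsf f)}$ is well-defined on $\ell$ and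 on $p$ (i.e. $1\le\nu(\mathsf f)\le n$). *)

theory Defs
  imports Main
begin

section \<open>Meta-terms modulo \<open>\<alpha>\<close>\<close>

datatype 's ty = Base 's | Arr "'s ty" "'s ty" (infixr "\<rightarrow>\<^sub>t" 65)

fun argtys :: "'s ty \<Rightarrow> 's ty list" where
  "argtys (Base \<kappa>) = []"
| "argtys (\<sigma> \<rightarrow>\<^sub>t \<tau>) = \<sigma> # argtys \<tau>"

fun target :: "'s ty \<Rightarrow> 's" where
  "target (Base \<kappa>) = \<kappa>"
| "target (\<sigma> \<rightarrow>\<^sub>t \<tau>) = target \<tau>"

abbreviation arrs :: "'s ty list \<Rightarrow> 's ty \<Rightarrow> 's ty" where
  "arrs \<sigma>s \<tau> \<equiv> foldr Arr \<sigma>s \<tau>"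

text \<open>\<open>Sharp f\<close> is the marked version of \<open>f\<close>; the symbols \<open>Fresh n \<sigma>\<close> are the countably many
  symbols of each type that may occur in terms but not in rules.\<close>

datatype ('f, 's) fsym = Plain 'f | Sharp 'f | Fresh nat "'s ty"

text \<open>Locally nameless representation: bound variables are de Bruijn indices \<open>Bnd i\<close>, free
  variables are named, so that \<open>\<alpha>\<close>-equivalence is equality. Well-typed meta-terms (below) have no
  dangling index. Whenever a definition goes below a binder, the bound variable is replaced
  by a sufficiently fresh named variable.\<close>

datatype ('f, 'v, 'm, 's) mterm =
    Bnd nat
  | Var 'v
  | Fun "('f, 's) fsym"
  | App "('f, 'v, 'm, 's) mterm" "('f, 'v, 'm, 's) mterm"
  | Abs "'s ty" "('f, 'v, 'm, 's) mterm"
  | MApp 'm "('f, 'v, 'm, 's) mterm list"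

abbreviation apps ::
  "('f, 'v, 'm, 's) mterm \<Rightarrow> ('f, 'v, 'm, 's) mterm list \<Rightarrow> ('f, 'v, 'm, 's) mterm" where
  "apps s ts \<equiv> foldl App s ts"

fun hd_of :: "('f, 'v, 'm, 's) mterm \<Rightarrow> ('f, 'v, 'm, 's) mterm" where
  "hd_of (App s t) = hd_of s"
| "hd_of s = s"

fun args_of :: "('f, 'v, 'm, 's) mterm \<Rightarrow> ('f, 'v, 'm, 's) mterm list" where
  "args_of (App s t) = args_of s @ [t]"
| "args_of s = []"

fun FV :: "('f, 'v, 'm, 's) mterm \<Rightarrow> 'v set" where
  "FV (Bnd i) = {}"
| "FV (Var x) = {x}"
| "FV (Fun f) = {}"
| "FV (App s t) = FV s \<union> FV t"
| "FV (Abs \<sigma> s) = FV s"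
| "FV (MApp Z ss) = (\<Union>s\<in>set ss. FV s)"

fun FMV :: "('f, 'v, 'm, 's) mterm \<Rightarrow> 'm set" where
  "FMV (Bnd i) = {}"
| "FMV (Var x) = {}"
| "FMV (Fun f) = {}"
| "FMV (App s t) = FMV s \<union> FMV t"
| "FMV (Abs \<sigma> s) = FMV s"
| "FMV (MApp Z ss) = insert Z (\<Union>s\<in>set ss. FMV s)"

fun syms :: "('f, 'v, 'm, 's) mterm \<Rightarrow> ('f, 's) fsym set" where
  "syms (Bnd i) = {}"
| "syms (Var x) = {}"
| "syms (Fun f) = {f}"
| "syms (App s t) = syms s \<union> syms t"
| "syms (Abs \<sigma> s) = syms s"
| "syms (MApp Z ss) = (\<Union>s\<in>set ss. syms s)"

text \<open>Dangling indices.\<close>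

fun loose :: "('f, 'v, 'm, 's) mterm \<Rightarrow> nat set" where
  "loose (Bnd i) = {i}"
| "loose (Var x) = {}"
| "loose (Fun f) = {}"
| "loose (App s t) = loose s \<union> loose t"
| "loose (Abs \<sigma> s) = {i. Suc i \<in> loose s}"
| "loose (MApp Z ss) = (\<Union>s\<in>set ss. loose s)"

text \<open>\<open>lift d k s\<close> adds \<open>d\<close> to all indices of \<open>s\<close> that are at least \<open>k\<close>.\<close>

fun lift :: "nat \<Rightarrow> nat \<Rightarrow> ('f, 'v, 'm, 's) mterm \<Rightarrow> ('f, 'v, 'm, 's) mterm" where
  "lift d k (Bnd i) = Bnd (if i < k then i else i + d)"
| "lift d k (Var x) = Var x"
| "lift d k (Fun f) = Fun f"
| "lift d k (App s t) = App (lift d k s) (lift d k t)"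
| "lift d k (Abs \<sigma> s) = Abs \<sigma> (lift d (Suc k) s)"
| "lift d k (MApp Z ss) = MApp Z (map (lift d k) ss)"

text \<open>\<open>inst k [u\<^sub>0,\<dots>,u\<^sub>n\<^sub>-\<^sub>1] s\<close> is the capture-avoiding simultaneous replacement of the indices
  \<open>k,\<dots>,k+n-1\<close> in \<open>s\<close> by \<open>u\<^sub>0,\<dots>,u\<^sub>n\<^sub>-\<^sub>1\<close>.\<close>

fun inst :: "nat \<Rightarrow> ('f, 'v, 'm, 's) mterm list \<Rightarrow> ('f, 'v, 'm, 's) mterm
    \<Rightarrow> ('f, 'v, 'm, 's) mterm" where
  "inst k us (Bnd i) =
     (if i < k then Bnd i
      else if i < k + length us then lift k 0 (us ! (i - k))
      else Bnd (i - length us))"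
| "inst k us (Var x) = Var x"
| "inst k us (Fun f) = Fun f"
| "inst k us (App s t) = App (inst k us s) (inst k us t)"
| "inst k us (Abs \<sigma> s) = Abs \<sigma> (inst (Suc k) us s)"
| "inst k us (MApp Z ss) = MApp Z (map (inst k us) ss)"

text \<open>With \<open>\<lambda>x.s\<close> represented by \<open>Abs \<sigma> s\<close>, \<open>subst0 s t\<close> is \<open>s[x := t]\<close>.\<close>

abbreviation subst0 ::
  "('f, 'v, 'm, 's) mterm \<Rightarrow> ('f, 'v, 'm, 's) mterm \<Rightarrow> ('f, 'v, 'm, 's) mterm" where
  "subst0 s t \<equiv> inst 0 [t] s"

text \<open>Turns the named variable \<open>x\<close> into the index \<open>k\<close>, so \<open>\<lambda>x.s\<close> is \<open>Abs \<sigma> (bind_var 0 x s)\<close>.\<close>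

fun bind_var :: "nat \<Rightarrow> 'v \<Rightarrow> ('f, 'v, 'm, 's) mterm \<Rightarrow> ('f, 'v, 'm, 's) mterm" where
  "bind_var k x (Bnd i) = Bnd (if i < k then i else Suc i)"
| "bind_var k x (Var y) = (if y = x then Bnd k else Var y)"
| "bind_var k x (Fun f) = Fun f"
| "bind_var k x (App s t) = App (bind_var k x s) (bind_var k x t)"
| "bind_var k x (Abs \<sigma> s) = Abs \<sigma> (bind_var (Suc k) x s)"
| "bind_var k x (MApp Z ss) = MApp Z (map (bind_var k x) ss)"

fun lam_count :: "('f, 'v, 'm, 's) mterm \<Rightarrow> nat" where
  "lam_count (Abs \<sigma> s) = Suc (lam_count s)"
| "lam_count s = 0"

fun strip_lams :: "nat \<Rightarrow> ('f, 'v, 'm, 's) mterm \<Rightarrow> ('f, 'v, 'm, 's) mterm" where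
  "strip_lams (Suc n) (Abs \<sigma> s) = strip_lams n s"
| "strip_lams n s = s"

text \<open>\<open>meta_app (\<lambda>x\<^sub>1\<dots>x\<^sub>n.u) [s\<^sub>1,\<dots>,s\<^sub>k] = u[x\<^sub>1:=s\<^sub>1,\<dots>,x\<^sub>n:=s\<^sub>n] s\<^sub>n\<^sub>+\<^sub>1 \<dots> s\<^sub>k\<close>, where \<open>n = k\<close>, or \<open>n < k\<close> and
  \<open>u\<close> is not an abstraction. In the body \<open>u\<close>, the variable \<open>x\<^sub>i\<close> is the index \<open>n - i\<close>.\<close>

definition meta_app ::
  "('f, 'v, 'm, 's) mterm \<Rightarrow> ('f, 'v, 'm, 's) mterm list \<Rightarrow> ('f, 'v, 'm, 's) mterm" where
  "meta_app t ss =
     (let n = min (length ss) (lam_count t)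
      in apps (inst 0 (rev (take n ss)) (strip_lams n t)) (drop n ss))"

text \<open>All substitutions that are needed have only meta-variables in their domain.\<close>

type_synonym ('f, 'v, 'm, 's) msub = "'m \<Rightarrow> ('f, 'v, 'm, 's) mterm option"

fun msubst :: "('f, 'v, 'm, 's) msub \<Rightarrow> ('f, 'v, 'm, 's) mterm \<Rightarrow> ('f, 'v, 'm, 's) mterm" where
  "msubst \<gamma> (Bnd i) = Bnd i"
| "msubst \<gamma> (Var x) = Var x"
| "msubst \<gamma> (Fun f) = Fun f"
| "msubst \<gamma> (App s t) = App (msubst \<gamma> s) (msubst \<gamma> t)"
| "msubst \<gamma> (Abs \<sigma> s) = Abs \<sigma> (msubst \<gamma> s)"
| "msubst \<gamma> (MApp Z ss) =
     (case \<gamma> Z of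
        None \<Rightarrow> MApp Z (map (msubst \<gamma>) ss)
      | Some t \<Rightarrow> meta_app t (map (msubst \<gamma>) ss))"

text \<open>The list of all occurrences of meta-variables.\<close>

fun mv_occs :: "('f, 'v, 'm, 's) mterm \<Rightarrow> 'm list" where
  "mv_occs (Bnd i) = []"
| "mv_occs (Var x) = []"
| "mv_occs (Fun f) = []"
| "mv_occs (App s t) = mv_occs s @ mv_occs t"
| "mv_occs (Abs \<sigma> s) = mv_occs s"
| "mv_occs (MApp Z ss) = Z # concat (map mv_occs ss)"

text \<open>Below \<open>k\<close> binders, each meta-variable is applied to all \<open>k\<close> variables bound there.\<close>

fun fully_ext :: "nat \<Rightarrow> ('f, 'v, 'm, 's) mterm \<Rightarrow> bool" where
  "fully_ext k (Bnd i) = True"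
| "fully_ext k (Var x) = True"
| "fully_ext k (Fun f) = True"
| "fully_ext k (App s t) = (fully_ext k s \<and> fully_ext k t)"
| "fully_ext k (Abs \<sigma> s) = fully_ext (Suc k) s"
| "fully_ext k (MApp Z ss) = ((\<forall>i<k. Bnd i \<in> set ss) \<and> (\<forall>s\<in>set ss. fully_ext k s))"

definition fully_ext_linear :: "('f, 'v, 'm, 's) mterm \<Rightarrow> bool" where
  "fully_ext_linear l \<longleftrightarrow> distinct (mv_occs l) \<and> fully_ext 0 l"

definition SN :: "('a \<Rightarrow> 'a \<Rightarrow> bool) \<Rightarrow> 'a \<Rightarrow> bool" where
  "SN r s \<longleftrightarrow> \<not> (\<exists>q. q 0 = s \<and> (\<forall>i::nat. r (q i) (q (Suc i))))"


section \<open>Dependency pair problems\<close>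

type_synonym ('f, 'v, 'm, 's) rule = "('f, 'v, 'm, 's) mterm \<times> ('f, 'v, 'm, 's) mterm"

text \<open>\<open>(l, p, A)\<close> is the dependency pair \<open>l \<Rrightarrow> p (A)\<close>; \<open>(Z, i) \<in> A\<close> is the condition \<open>Z : i\<close>,
  with argument positions counted from 1.\<close>

type_synonym ('f, 'v, 'm, 's) dp =
  "('f, 'v, 'm, 's) mterm \<times> ('f, 'v, 'm, 's) mterm \<times> ('m \<times> nat) set"

datatype ('f, 'v, 'm, 's) mflag =
  Minimal | Arbitrary | Computable "('f, 'v, 'm, 's) rule set"

datatype fflag = Formative | Unrestricted

inductive mflag_gen :: "('f, 'v, 'm, 's) mflag \<Rightarrow> ('f, 'v, 'm, 's) mflag \<Rightarrow> bool" where
  "mflag_gen (Computable U) Minimal"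
| "mflag_gen Minimal Arbitrary"

abbreviation mflag_ge :: "('f, 'v, 'm, 's) mflag \<Rightarrow> ('f, 'v, 'm, 's) mflag \<Rightarrow> bool" where
  "mflag_ge \<equiv> mflag_gen\<^sup>*\<^sup>*"

type_synonym ('f, 'v, 'm, 's) dpp =
  "('f, 'v, 'm, 's) dp set \<times> ('f, 'v, 'm, 's) rule set \<times> ('f, 'v, 'm, 's) mflag \<times> fflag"

datatype ('f, 'v, 'm, 's) answer = NO | Problems "('f, 'v, 'm, 's) dpp set"

definition conservative :: "('f, 'v, 'm, 's) dp \<Rightarrow> bool" where
  "conservative = (\<lambda>(l, p, A). FMV p \<subseteq> FMV l)"

text \<open>\<open>\<gamma>(Z) = \<lambda>x\<^sub>1\<dots>x\<^sub>j.t\<close> with \<open>t\<close> not an abstraction, and \<open>i > j\<close> or \<open>x\<^sub>i \<in> FV(t)\<close>. A meta-variable \<open>Z\<close>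
  outside the domain is mapped to itself, that is to \<open>\<lambda>x\<^sub>1\<dots>x\<^sub>k.Z\<langle>x\<^sub>1,\<dots>,x\<^sub>k\<rangle>\<close>, which satisfies this.\<close>

definition resp :: "('f, 'v, 'm, 's) msub \<Rightarrow> ('m \<times> nat) set \<Rightarrow> bool" where
  "resp \<gamma> A \<longleftrightarrow>
     (\<forall>(Z, i)\<in>A. \<forall>t. \<gamma> Z = Some t \<longrightarrow>
        (let j = lam_count t
         in j < i \<or> 1 \<le> i \<and> i \<le> j \<and> j - i \<in> loose (strip_lams j t)))"

definition nu_bar_defined :: "(('f, 's) fsym \<Rightarrow> nat) \<Rightarrow> ('f, 'v, 'm, 's) mterm \<Rightarrow> bool" where
  "nu_bar_defined \<nu> s \<longleftrightarrow> (\<exists>f. hd_of s = Fun f \<and> 1 \<le> \<nu> f \<and> \<nu> f \<le> length (args_of s))"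

definition nu_bar ::
  "(('f, 's) fsym \<Rightarrow> nat) \<Rightarrow> ('f, 'v, 'm, 's) mterm \<Rightarrow> ('f, 'v, 'm, 's) mterm" where
  "nu_bar \<nu> s = args_of s ! (\<nu> (THE f. hd_of s = Fun f) - 1)"

text \<open>Only the values of \<open>\<nu>\<close> on the head symbols of \<open>P\<close> matter.\<close>

definition projection_function ::
  "('f, 'v, 'm, 's) dp set \<Rightarrow> (('f, 's) fsym \<Rightarrow> nat) \<Rightarrow> bool" where
  "projection_function P \<nu> \<longleftrightarrow> (\<forall>(l, p, A)\<in>P. nu_bar_defined \<nu> l \<and> nu_bar_defined \<nu> p)"

locale static_dp =
  fixes fty :: "'f \<Rightarrow> 's ty"
    and vty :: "'v \<Rightarrow> 's ty"
    and mty :: "'m \<Rightarrow> 's ty"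
    and arity :: "'m \<Rightarrow> nat"
    and sort_ge :: "'s \<Rightarrow> 's \<Rightarrow> bool"
  assumes inf_vars: "\<And>\<sigma>. infinite {x. vty x = \<sigma>}"
    and inf_mvars: "\<And>\<sigma>. infinite {Z. mty Z = \<sigma>}"
    and arity_le: "\<And>Z. arity Z \<le> length (argtys (mty Z))"
    and sort_refl: "\<And>\<iota>. sort_ge \<iota> \<iota>"
    and sort_trans: "\<And>\<iota> \<kappa> \<mu>. sort_ge \<iota> \<kappa> \<Longrightarrow> sort_ge \<kappa> \<mu> \<Longrightarrow> sort_ge \<iota> \<mu>"
    and sort_wf: "wfP (\<lambda>\<kappa> \<iota>. sort_ge \<iota> \<kappa> \<and> \<not> sort_ge \<kappa> \<iota>)"
begin

subsection \<open>Rewriting\<close>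

primrec symty :: "('f, 's) fsym \<Rightarrow> 's ty" where
  "symty (Plain f) = fty f"
| "symty (Sharp f) = fty f"
| "symty (Fresh n \<sigma>) = \<sigma>"

text \<open>\<open>\<Gamma>\<close> lists the types of the dangling indices.\<close>

inductive typed :: "'s ty list \<Rightarrow> ('f, 'v, 'm, 's) mterm \<Rightarrow> 's ty \<Rightarrow> bool" where
  "i < length \<Gamma> \<Longrightarrow> typed \<Gamma> (Bnd i) (\<Gamma> ! i)"
| "typed \<Gamma> (Var x) (vty x)"
| "typed \<Gamma> (Fun f) (symty f)"
| "typed \<Gamma> s (\<sigma> \<rightarrow>\<^sub>t \<tau>) \<Longrightarrow> typed \<Gamma> t \<sigma> \<Longrightarrow> typed \<Gamma> (App s t) \<tau>"
| "typed (\<sigma> # \<Gamma>) s \<tau> \<Longrightarrow> typed \<Gamma> (Abs \<sigma> s) (\<sigma> \<rightarrow>\<^sub>t \<tau>)"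
| "mty Z = arrs \<sigma>s \<tau> \<Longrightarrow> length \<sigma>s = arity Z \<Longrightarrow> list_all2 (typed \<Gamma>) ss \<sigma>s
    \<Longrightarrow> typed \<Gamma> (MApp Z ss) \<tau>"

definition closed_meta_term :: "('f, 'v, 'm, 's) mterm \<Rightarrow> 's ty \<Rightarrow> bool" where
  "closed_meta_term s \<sigma> \<longleftrightarrow> typed [] s \<sigma> \<and> FV s = {}"

definition tm :: "('f, 'v, 'm, 's) mterm \<Rightarrow> 's ty \<Rightarrow> bool" where
  "tm s \<sigma> \<longleftrightarrow> typed [] s \<sigma> \<and> FMV s = {}"

inductive strict_subterm :: "('f, 'v, 'm, 's) mterm \<Rightarrow> ('f, 'v, 'm, 's) mterm \<Rightarrow> bool"
    (infix "\<rhd>" 50)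
  and subterm :: "('f, 'v, 'm, 's) mterm \<Rightarrow> ('f, 'v, 'm, 's) mterm \<Rightarrow> bool"
    (infix "\<unrhd>" 50) where
  "s \<unrhd> s"
| "s \<rhd> t \<Longrightarrow> s \<unrhd> t"
| "vty x = \<sigma> \<Longrightarrow> x \<notin> FV s \<Longrightarrow> subst0 s (Var x) \<unrhd> t \<Longrightarrow> Abs \<sigma> s \<rhd> t"
| "s\<^sub>1 \<unrhd> t \<Longrightarrow> App s\<^sub>1 s\<^sub>2 \<rhd> t"
| "s\<^sub>2 \<unrhd> t \<Longrightarrow> App s\<^sub>1 s\<^sub>2 \<rhd> t"

inductive pattern :: "('f, 'v, 'm, 's) mterm \<Rightarrow> bool" where
  "distinct xs \<Longrightarrow> pattern (MApp Z (map Var xs))"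
| "vty x = \<sigma> \<Longrightarrow> x \<notin> FV l \<Longrightarrow> pattern (subst0 l (Var x)) \<Longrightarrow> pattern (Abs \<sigma> l)"
| "(\<forall>l\<in>set ls. pattern l) \<Longrightarrow> pattern (apps (Fun f) ls)"
| "(\<forall>l\<in>set ls. pattern l) \<Longrightarrow> pattern (apps (Var x) ls)"

definition is_rule :: "('f, 'v, 'm, 's) rule \<Rightarrow> bool" where
  "is_rule = (\<lambda>(l, r).
     (\<exists>\<sigma>. closed_meta_term l \<sigma> \<and> closed_meta_term r \<sigma>) \<and>
     pattern l \<and> (\<exists>f ls. l = apps (Fun f) ls) \<and> FMV r \<subseteq> FMV l \<and>
     (\<forall>n \<sigma>. Fresh n \<sigma> \<notin> syms l \<union> syms r))"

abbreviation rules :: "('f, 'v, 'm, 's) rule set \<Rightarrow> bool" where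
  "rules R \<equiv> \<forall>\<rho>\<in>R. is_rule \<rho>"

definition is_sub :: "('f, 'v, 'm, 's) msub \<Rightarrow> bool" where
  "is_sub \<gamma> \<longleftrightarrow> (\<forall>Z t. \<gamma> Z = Some t \<longrightarrow> tm t (mty Z))"

inductive rewr :: "('f, 'v, 'm, 's) rule set \<Rightarrow> ('f, 'v, 'm, 's) mterm
    \<Rightarrow> ('f, 'v, 'm, 's) mterm \<Rightarrow> bool" for R where
  "(l, r) \<in> R \<Longrightarrow> is_sub \<delta> \<Longrightarrow> dom \<delta> = FMV l \<Longrightarrow> rewr R (msubst \<delta> l) (msubst \<delta> r)"
| "rewr R (App (Abs \<sigma> s) t) (subst0 s t)"
| "rewr R s s' \<Longrightarrow> rewr R (App s t) (App s' t)"
| "rewr R t t' \<Longrightarrow> rewr R (App s t) (App s t')"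
| "vty x = \<sigma> \<Longrightarrow> x \<notin> FV s \<union> FV s' \<Longrightarrow> rewr R (subst0 s (Var x)) (subst0 s' (Var x))
    \<Longrightarrow> rewr R (Abs \<sigma> s) (Abs \<sigma> s')"

text \<open>The relation \<open>\<rightarrow>\<^sub>R\<close>, which relates (well-typed) terms of the same type.\<close>

definition step :: "('f, 'v, 'm, 's) rule set \<Rightarrow> ('f, 'v, 'm, 's) mterm
    \<Rightarrow> ('f, 'v, 'm, 's) mterm \<Rightarrow> bool" where
  "step R s t \<longleftrightarrow> (\<exists>\<sigma>. tm s \<sigma> \<and> tm t \<sigma>) \<and> rewr R s t"

definition is_dp :: "('f, 'v, 'm, 's) dp \<Rightarrow> bool" where
  "is_dp = (\<lambda>(l, p, A).
     (\<exists>\<sigma>. closed_meta_term l \<sigma>) \<and> pattern l \<and> (\<exists>f ls. l = apps (Fun f) ls) \<and>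
     (\<exists>\<tau>. closed_meta_term p \<tau>) \<and> (\<exists>g ps. p = apps (Fun g) ps))"

inductive beta_sub :: "('m \<times> nat) set \<Rightarrow> ('f, 'v, 'm, 's) mterm
    \<Rightarrow> ('f, 'v, 'm, 's) mterm \<Rightarrow> bool" for A where
  "beta_sub A s s"
| "vty x = \<sigma> \<Longrightarrow> x \<notin> FV u \<Longrightarrow> beta_sub A (subst0 u (Var x)) t \<Longrightarrow> beta_sub A (Abs \<sigma> u) t"
| "s \<in> set (s\<^sub>0 # ss) \<Longrightarrow> beta_sub A s t \<Longrightarrow> beta_sub A (apps (Abs \<sigma> u) (s\<^sub>0 # ss)) t"
| "beta_sub A (apps (subst0 u s\<^sub>0) ss) t \<Longrightarrow> beta_sub A (apps (Abs \<sigma> u) (s\<^sub>0 # ss)) t"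
| "s \<in> set ss \<Longrightarrow> beta_sub A s t \<Longrightarrow> beta_sub A (apps (Fun f) ss) t"
| "s \<in> set ss \<Longrightarrow> beta_sub A s t \<Longrightarrow> beta_sub A (apps (Var x) ss) t"
| "s \<in> set ss \<Longrightarrow> beta_sub A s t \<Longrightarrow> beta_sub A (apps (MApp Z ts) ss) t"
| "1 \<le> i \<Longrightarrow> i \<le> length ts \<Longrightarrow> (Z, i) \<in> A \<Longrightarrow> beta_sub A (ts ! (i - 1)) t
    \<Longrightarrow> beta_sub A (apps (MApp Z ts) ss) t"

subsection \<open>Computability\<close>

definition sort_gt :: "'s \<Rightarrow> 's \<Rightarrow> bool" where
  "sort_gt \<iota> \<kappa> \<longleftrightarrow> sort_ge \<iota> \<kappa> \<and> \<not> sort_ge \<kappa> \<iota>"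

text \<open>\<open>\<iota> \<succeq>\<^sub>+ \<sigma>\<close> and \<open>\<iota> \<succ>\<^sub>- \<sigma>\<close>.\<close>

fun ge_pos :: "'s \<Rightarrow> 's ty \<Rightarrow> bool" and gt_neg :: "'s \<Rightarrow> 's ty \<Rightarrow> bool" where
  "ge_pos \<iota> (Base \<kappa>) = sort_ge \<iota> \<kappa>"
| "ge_pos \<iota> (\<sigma> \<rightarrow>\<^sub>t \<tau>) = (gt_neg \<iota> \<sigma> \<and> ge_pos \<iota> \<tau>)"
| "gt_neg \<iota> (Base \<kappa>) = sort_gt \<iota> \<kappa>"
| "gt_neg \<iota> (\<sigma> \<rightarrow>\<^sub>t \<tau>) = (ge_pos \<iota> \<sigma> \<and> gt_neg \<iota> \<tau>)"

definition Acc :: "('f, 's) fsym \<Rightarrow> nat set" where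
  "Acc f = {i. 1 \<le> i \<and> i \<le> length (argtys (symty f)) \<and>
               ge_pos (target (symty f)) (argtys (symty f) ! (i - 1))}"

definition base_tm :: "('f, 'v, 'm, 's) mterm \<Rightarrow> bool" where
  "base_tm s \<longleftrightarrow> (\<exists>\<kappa>. tm s (Base \<kappa>))"

definition RC_set :: "('f, 'v, 'm, 's) rule set \<Rightarrow> ('f, 'v, 'm, 's) mterm set \<Rightarrow> bool" where
  "RC_set U I \<longleftrightarrow>
     (\<forall>s\<in>I. base_tm s \<and> SN (step U) s) \<and>
     (\<forall>s\<in>I. \<forall>t. step U s t \<longrightarrow> t \<in> I) \<and>
     (\<forall>x ss. base_tm (apps (Var x) ss) \<and> (\<forall>t. step U (apps (Var x) ss) t \<longrightarrow> t \<in> I)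
        \<longrightarrow> apps (Var x) ss \<in> I) \<and>
     (\<forall>\<sigma> u s\<^sub>0 ss. base_tm (apps (Abs \<sigma> u) (s\<^sub>0 # ss)) \<and>
        (\<forall>t. step U (apps (Abs \<sigma> u) (s\<^sub>0 # ss)) t \<longrightarrow> t \<in> I)
        \<longrightarrow> apps (Abs \<sigma> u) (s\<^sub>0 # ss) \<in> I)"

fun comp_at :: "('f, 'v, 'm, 's) mterm set \<Rightarrow> 's ty \<Rightarrow> ('f, 'v, 'm, 's) mterm \<Rightarrow> bool" where
  "comp_at I (Base \<kappa>) s = (tm s (Base \<kappa>) \<and> s \<in> I)"
| "comp_at I (\<sigma> \<rightarrow>\<^sub>t \<tau>) s = (tm s (\<sigma> \<rightarrow>\<^sub>t \<tau>) \<and> (\<forall>t. comp_at I \<sigma> t \<longrightarrow> comp_at I \<tau> (App s t)))"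

definition computable :: "('f, 'v, 'm, 's) mterm set \<Rightarrow> ('f, 'v, 'm, 's) mterm \<Rightarrow> bool" where
  "computable I s \<longleftrightarrow> (\<exists>\<sigma>. comp_at I \<sigma> s)"

inductive acc_step :: "('f, 'v, 'm, 's) mterm set \<Rightarrow> ('f, 'v, 'm, 's) mterm
    \<Rightarrow> ('f, 'v, 'm, 's) mterm \<Rightarrow> bool" for I where
  "base_tm (apps (Fun f) ss) \<Longrightarrow> base_tm (apps (ss ! (i - 1)) ts) \<Longrightarrow> i \<in> Acc f
    \<Longrightarrow> (\<forall>t\<in>set ts. computable I t) \<Longrightarrow> acc_step I (apps (Fun f) ss) (apps (ss ! (i - 1)) ts)"

definition comp_op :: "('f, 'v, 'm, 's) rule set \<Rightarrow> ('f, 'v, 'm, 's) mterm set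
    \<Rightarrow> ('f, 'v, 'm, 's) mterm set" where
  "comp_op U I = {s. base_tm s \<and> SN (\<lambda>a b. step U a b \<or> acc_step I a b) s \<and>
     (\<forall>f ss. (step U)\<^sup>*\<^sup>* s (apps (Fun f) ss) \<longrightarrow> (\<forall>i\<in>Acc f. computable I (ss ! (i - 1))))}"

text \<open>A set as required exists, see \<open>C_of_spec\<close> below.\<close>

definition C_of :: "('f, 'v, 'm, 's) rule set \<Rightarrow> ('f, 'v, 'm, 's) mterm set" where
  "C_of U = (SOME I. RC_set U I \<and> I = comp_op U I)"

subsection \<open>Formative reductions\<close>

text \<open>\<open>formative R s l \<gamma>\<close>: there is an \<open>l\<close>-formative reduction from \<open>s\<close> to \<open>l\<gamma>\<close>.\<close>

inductive formative :: "('f, 'v, 'm, 's) rule set \<Rightarrow> ('f, 'v, 'm, 's) mterm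
    \<Rightarrow> ('f, 'v, 'm, 's) mterm \<Rightarrow> ('f, 'v, 'm, 's) msub \<Rightarrow> bool" for R where
  "\<not> fully_ext_linear l \<Longrightarrow> (step R)\<^sup>*\<^sup>* s (msubst \<gamma> l) \<Longrightarrow> formative R s l \<gamma>"
| "formative R (msubst \<gamma> (MApp Z (map Var xs))) (MApp Z (map Var xs)) \<gamma>"
| "list_all2 (\<lambda>s l. formative R s l \<gamma>) ss ls
    \<Longrightarrow> formative R (apps (Fun f) ss) (apps (Fun f) ls) \<gamma>"
| "list_all2 (\<lambda>s l. formative R s l \<gamma>) ss ls
    \<Longrightarrow> formative R (apps (Var x) ss) (apps (Var x) ls) \<gamma>"
| "vty x = \<sigma> \<Longrightarrow> x \<notin> FV s \<union> FV l \<union> (\<Union>t\<in>ran \<gamma>. FV t)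
    \<Longrightarrow> formative R (subst0 s (Var x)) (subst0 l (Var x)) \<gamma>
    \<Longrightarrow> formative R (Abs \<sigma> s) (Abs \<sigma> l) \<gamma>"
| "formative R (apps (subst0 u v) ws) l \<gamma> \<Longrightarrow> formative R (apps (Abs \<sigma> u) (v # ws)) l \<gamma>"
| "(\<forall>Z ss. l \<noteq> MApp Z ss) \<Longrightarrow> (l', r') \<in> R
    \<Longrightarrow> Zs' = map (\<lambda>Z. MApp Z []) Zs \<Longrightarrow> typed [] (apps l' Zs') \<tau>
    \<Longrightarrow> is_sub \<delta> \<Longrightarrow> dom \<delta> = FMV (apps l' Zs')
    \<Longrightarrow> formative R s (apps l' Zs') \<delta> \<Longrightarrow> formative R (msubst \<delta> (apps r' Zs')) l \<gamma>
    \<Longrightarrow> formative R s l \<gamma>"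

subsection \<open>Chains\<close>

text \<open>The infinite chain \<open>[(d 0, s 0, t 0), (d 1, s 1, t 1), \<dots>]\<close>, together with the
  substitutions \<open>g i\<close> that witness it.\<close>

definition inf_chain :: "('f, 'v, 'm, 's) dp set \<Rightarrow> ('f, 'v, 'm, 's) rule set
    \<Rightarrow> (nat \<Rightarrow> ('f, 'v, 'm, 's) dp) \<Rightarrow> (nat \<Rightarrow> ('f, 'v, 'm, 's) mterm)
    \<Rightarrow> (nat \<Rightarrow> ('f, 'v, 'm, 's) mterm) \<Rightarrow> (nat \<Rightarrow> ('f, 'v, 'm, 's) msub) \<Rightarrow> bool" where
  "inf_chain P R d s t g \<longleftrightarrow>
     (\<forall>i. d i \<in> P \<and>
       (case d i of (l, p, A) \<Rightarrow>
          is_sub (g i) \<and> dom (g i) = FMV l \<union> FMV p \<and> resp (g i) A \<and>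
          s i = msubst (g i) l \<and> t i = msubst (g i) p) \<and>
       (\<exists>f us ws. t i = apps (Fun f) us \<and> s (Suc i) = apps (Fun f) ws \<and>
          list_all2 (step R)\<^sup>*\<^sup>* us ws))"

definition minimal_chain :: "('f, 'v, 'm, 's) rule set
    \<Rightarrow> (nat \<Rightarrow> ('f, 'v, 'm, 's) mterm) \<Rightarrow> bool" where
  "minimal_chain R t \<longleftrightarrow> (\<forall>i u. t i \<rhd> u \<longrightarrow> SN (step R) u)"

definition lambdas :: "'v list \<Rightarrow> ('f, 'v, 'm, 's) mterm \<Rightarrow> ('f, 'v, 'm, 's) mterm" where
  "lambdas xs v = foldr (\<lambda>x s. Abs (vty x) (bind_var 0 x s)) xs v"

definition computable_chain :: "('f, 'v, 'm, 's) rule set \<Rightarrow> ('f, 'v, 'm, 's) rule set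
    \<Rightarrow> (nat \<Rightarrow> ('f, 'v, 'm, 's) dp) \<Rightarrow> (nat \<Rightarrow> ('f, 'v, 'm, 's) msub) \<Rightarrow> bool" where
  "computable_chain U R d g \<longleftrightarrow>
     (\<forall>a b. step R a b \<longrightarrow> step U a b) \<and>
     (\<forall>i. case d i of (l, p, A) \<Rightarrow>
        \<forall>B v xs. beta_sub B p v \<and> resp (g i) B \<and> distinct xs \<and> set xs = FV v
          \<longrightarrow> computable (C_of U) (msubst (g i) (lambdas xs v)))"

definition formative_chain :: "('f, 'v, 'm, 's) rule set
    \<Rightarrow> (nat \<Rightarrow> ('f, 'v, 'm, 's) dp) \<Rightarrow> (nat \<Rightarrow> ('f, 'v, 'm, 's) mterm)
    \<Rightarrow> (nat \<Rightarrow> ('f, 'v, 'm, 's) msub) \<Rightarrow> bool" where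
  "formative_chain R d t g \<longleftrightarrow> (\<forall>i. formative R (t i) (fst (d (Suc i))) (g (Suc i)))"

subsection \<open>Processors\<close>

definition is_dpp :: "('f, 'v, 'm, 's) dpp \<Rightarrow> bool" where
  "is_dpp = (\<lambda>(P, R, m, f).
     (\<forall>d\<in>P. is_dp d) \<and> rules R \<and> (\<forall>U. m = Computable U \<longrightarrow> rules U))"

definition finite_dpp :: "('f, 'v, 'm, 's) dpp \<Rightarrow> bool" where
  "finite_dpp = (\<lambda>(P, R, m, f).
     \<not> (\<exists>d s t g. inf_chain P R d s t g \<and>
          (\<forall>U. m = Computable U \<longrightarrow> computable_chain U R d g) \<and>
          (m = Minimal \<longrightarrow> minimal_chain R t) \<and>
          (f = Formative \<longrightarrow> formative_chain R d t g)))"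

definition infinite_dpp :: "('f, 'v, 'm, 's) dpp \<Rightarrow> bool" where
  "infinite_dpp = (\<lambda>(P, R, m, f).
     (\<exists>s \<sigma>. tm s \<sigma> \<and> \<not> SN (step R) s) \<or>
     (\<exists>d s t g. inf_chain P R d s t g \<and> (\<forall>i. conservative (d i))))"

definition sound :: "(('f, 'v, 'm, 's) dpp \<Rightarrow> ('f, 'v, 'm, 's) answer) \<Rightarrow> bool" where
  "sound Proc \<longleftrightarrow>
     (\<forall>M. is_dpp M \<longrightarrow>
        (\<exists>N. Proc M = Problems N \<and> (\<forall>M'\<in>N. finite_dpp M')) \<longrightarrow> finite_dpp M)"

definition complete :: "(('f, 'v, 'm, 's) dpp \<Rightarrow> ('f, 'v, 'm, 's) answer) \<Rightarrow> bool" where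
  "complete Proc \<longleftrightarrow>
     (\<forall>M. is_dpp M \<longrightarrow>
        Proc M = NO \<or> (\<exists>N. Proc M = Problems N \<and> (\<exists>M'\<in>N. infinite_dpp M')) \<longrightarrow> infinite_dpp M)"

definition subcrit :: "('f, 'v, 'm, 's) dpp \<Rightarrow> ('f, 'v, 'm, 's) dpp \<Rightarrow> bool" where
  "subcrit M M' \<longleftrightarrow>
     (\<exists>P\<^sub>1 P\<^sub>2 R m f \<nu>. M = (P\<^sub>1 \<union> P\<^sub>2, R, m, f) \<and> P\<^sub>1 \<inter> P\<^sub>2 = {} \<and> mflag_ge m Minimal \<and>
        projection_function (P\<^sub>1 \<union> P\<^sub>2) \<nu> \<and>
        (\<forall>(l, p, A)\<in>P\<^sub>1. nu_bar \<nu> l \<rhd> nu_bar \<nu> p) \<and>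
        (\<forall>(l, p, A)\<in>P\<^sub>2. nu_bar \<nu> l = nu_bar \<nu> p) \<and>
        M' = (P\<^sub>2, R, m, f))"

text \<open>The projection function, and with it the result, is not determined by the problem: any
  choice yields a subterm criterion processor.\<close>

definition subcrit_processor ::
  "(('f, 'v, 'm, 's) dpp \<Rightarrow> ('f, 'v, 'm, 's) answer) \<Rightarrow> bool" where
  "subcrit_processor Proc \<longleftrightarrow>
     (\<forall>M. is_dpp M \<longrightarrow>
        (if \<exists>M'. subcrit M M' then \<exists>M'. subcrit M M' \<and> Proc M = Problems {M'}
         else Proc M = Problems {M}))"

subsection \<open>Existence of the sets \<open>C\<^sub>U\<close>\<close>

text \<open>A fixpoint of \<open>comp_op U\<close> is built by recursion on the sort ordering, as a least fixpoint for
  each class of equivalent sorts; any fixpoint is an RC-set.\<close>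

lemma arrs_inj: "arrs \<sigma>s \<tau> = arrs \<sigma>s' \<tau>' \<Longrightarrow> length \<sigma>s = length \<sigma>s' \<Longrightarrow> \<sigma>s = \<sigma>s' \<and> \<tau> = \<tau>'"
proof (induction \<sigma>s arbitrary: \<sigma>s')
  case (Cons a \<sigma>s)
  then show ?case by (cases \<sigma>s') auto
qed simp

lemma typed_unique: "typed \<Gamma> s \<sigma> \<Longrightarrow> typed \<Gamma> s \<tau> \<Longrightarrow> \<sigma> = \<tau>"
proof (induction arbitrary: \<tau> rule: typed.induct)
  case (4 \<Gamma> s \<sigma> \<rho> t)
  from 4(5) obtain \<sigma>' where "typed \<Gamma> s (\<sigma>' \<rightarrow>\<^sub>t \<tau>)" by (cases rule: typed.cases) auto
  then have "\<sigma> \<rightarrow>\<^sub>t \<rho> = \<sigma>' \<rightarrow>\<^sub>t \<tau>" by (rule "4.IH"(1))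
  then show ?case by simp
next
  case (5 \<sigma> \<Gamma> s \<rho>)
  from 5(3) obtain \<rho>' where "\<tau> = \<sigma> \<rightarrow>\<^sub>t \<rho>'" "typed (\<sigma> # \<Gamma>) s \<rho>'"
    by (cases rule: typed.cases) auto
  with 5(2) show ?case by blast
next
  case (6 Z \<sigma>s \<rho> \<Gamma> ss)
  from 6(4) obtain \<sigma>s' where "mty Z = arrs \<sigma>s' \<tau>" "length \<sigma>s' = arity Z"
    by (cases rule: typed.cases) auto
  with 6(1,2) arrs_inj[of \<sigma>s \<rho> \<sigma>s' \<tau>] show ?case by metis
next
  case (1 i \<Gamma>)
  from 1(2) show ?case by (cases rule: typed.cases) auto
next
  case (2 \<Gamma> x)
  then show ?case by (cases rule: typed.cases) auto
next
  case (3 \<Gamma> f)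
  then show ?case by (cases rule: typed.cases) auto
qed

lemma tm_unique: "tm s \<sigma> \<Longrightarrow> tm s \<tau> \<Longrightarrow> \<sigma> = \<tau>"
  using typed_unique by (auto simp: tm_def)

lemma tm_App: "tm (App s t) \<tau> \<Longrightarrow> \<exists>\<sigma>. tm s (\<sigma> \<rightarrow>\<^sub>t \<tau>) \<and> tm t \<sigma>"
  unfolding tm_def by (erule conjE, cases rule: typed.cases) auto

lemma tm_apps: "tm (apps h ts) \<tau> \<Longrightarrow> \<exists>\<sigma>s. tm h (arrs \<sigma>s \<tau>) \<and> list_all2 tm ts \<sigma>s"
proof (induction ts arbitrary: h)
  case (Cons t ts)
  from Cons.IH[of "App h t"] Cons.prems obtain \<sigma>s
    where a: "tm (App h t) (arrs \<sigma>s \<tau>)" "list_all2 tm ts \<sigma>s" by auto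
  from tm_App[OF a(1)] obtain \<sigma> where "tm h (\<sigma> \<rightarrow>\<^sub>t arrs \<sigma>s \<tau>)" "tm t \<sigma>" by blast
  with a(2) show ?case by (intro exI[of _ "\<sigma> # \<sigma>s"]) auto
qed auto

lemma tm_Fun: "tm (Fun f) \<sigma> \<Longrightarrow> \<sigma> = symty f"
  unfolding tm_def by (erule conjE, cases rule: typed.cases) auto

lemma arrs_simps [simp]:
  "argtys (arrs \<sigma>s (Base \<kappa>)) = \<sigma>s" "target (arrs \<sigma>s \<tau>) = target \<tau>"
  by (induction \<sigma>s) auto

lemma ge_pos_arrs: "ge_pos \<iota> (arrs \<tau>s (Base \<kappa>)) \<longleftrightarrow> (\<forall>\<tau>\<in>set \<tau>s. gt_neg \<iota> \<tau>) \<and> sort_ge \<iota> \<kappa>"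
  by (induction \<tau>s) auto

lemma sort_gt_trans: "sort_ge \<iota> \<kappa> \<Longrightarrow> sort_gt \<kappa> \<mu> \<Longrightarrow> sort_gt \<iota> \<mu>"
  unfolding sort_gt_def using sort_trans by blast

lemma pos_neg_trans:
  assumes "sort_ge \<iota> \<kappa>"
  shows "(ge_pos \<kappa> \<sigma> \<longrightarrow> ge_pos \<iota> \<sigma>) \<and> (gt_neg \<kappa> \<sigma> \<longrightarrow> gt_neg \<iota> \<sigma>)"
  by (induction \<sigma>) (use assms sort_trans sort_gt_trans in auto)

lemma comp_at_tm: "comp_at I \<sigma> s \<Longrightarrow> tm s \<sigma>"
  by (cases \<sigma>) auto

lemma Acc_tm:
  assumes "tm (apps (Fun f) ss) (Base \<kappa>)" "i \<in> Acc f"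
  shows "\<exists>\<sigma>. tm (ss ! (i - 1)) \<sigma> \<and> ge_pos \<kappa> \<sigma>"
proof -
  from tm_apps[OF assms(1)] obtain \<sigma>s
    where f: "tm (Fun f) (arrs \<sigma>s (Base \<kappa>))" and ss: "list_all2 tm ss \<sigma>s" by auto
  from assms(2) have i: "1 \<le> i" "i \<le> length \<sigma>s" "ge_pos \<kappa> (\<sigma>s ! (i - 1))"
    unfolding Acc_def tm_Fun[OF f, symmetric] by simp_all
  then have "tm (ss ! (i - 1)) (\<sigma>s ! (i - 1))"
    using list_all2_nthD2[OF ss, of "i - 1"] by auto
  with i show ?thesis by blast
qed

lemma comp_at_mono:
  assumes lo: "\<And>s \<kappa>. sort_gt \<iota> \<kappa> \<Longrightarrow> tm s (Base \<kappa>) \<Longrightarrow> s \<in> J \<Longrightarrow> s \<in> I"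
    and le: "\<And>s \<kappa>. sort_ge \<iota> \<kappa> \<Longrightarrow> tm s (Base \<kappa>) \<Longrightarrow> s \<in> I \<Longrightarrow> s \<in> J"
  shows "(ge_pos \<iota> \<sigma> \<longrightarrow> comp_at I \<sigma> s \<longrightarrow> comp_at J \<sigma> s) \<and>
         (gt_neg \<iota> \<sigma> \<longrightarrow> comp_at J \<sigma> s \<longrightarrow> comp_at I \<sigma> s)"
  by (induction \<sigma> arbitrary: s) (use lo le in auto)

lemma steps_tm: "(step U)\<^sup>*\<^sup>* s t \<Longrightarrow> tm s \<sigma> \<Longrightarrow> tm t \<sigma>"
proof (induction rule: rtranclp_induct)
  case (step t u)
  then obtain \<tau> where "tm t \<tau>" "tm u \<tau>" by (auto simp: step_def)
  with step tm_unique[of t \<sigma> \<tau>] show ?case by simp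
qed

lemma comp_op_mono:
  assumes lo: "\<And>s \<kappa>. sort_gt \<iota> \<kappa> \<Longrightarrow> tm s (Base \<kappa>) \<Longrightarrow> s \<in> J \<Longrightarrow> s \<in> I"
    and le: "\<And>s \<kappa>. sort_ge \<iota> \<kappa> \<Longrightarrow> tm s (Base \<kappa>) \<Longrightarrow> s \<in> I \<Longrightarrow> s \<in> J"
    and s: "s \<in> comp_op U I" "tm s (Base \<kappa>)" "sort_ge \<iota> \<kappa>"
  shows "s \<in> comp_op U J"
proof -
  have mono: "ge_pos \<iota> \<sigma> \<Longrightarrow> comp_at I \<sigma> u \<Longrightarrow> comp_at J \<sigma> u"
    "gt_neg \<iota> \<sigma> \<Longrightarrow> comp_at J \<sigma> u \<Longrightarrow> comp_at I \<sigma> u" for \<sigma> u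
    using comp_at_mono[of \<iota> J I \<sigma> u] lo le by blast+
  define small where "small a \<longleftrightarrow> (\<exists>\<kappa>. tm a (Base \<kappa>) \<and> sort_ge \<iota> \<kappa>)" for a
  have acc: "acc_step I a b \<and> small b" if ab: "acc_step J a b" and a: "small a" for a b
    using ab
  proof cases
    case (1 f ss i ts)
    from a obtain \<kappa> where \<kappa>: "tm a (Base \<kappa>)" "sort_ge \<iota> \<kappa>" by (auto simp: small_def)
    from Acc_tm[of f ss \<kappa> i] 1 \<kappa> obtain \<sigma>
      where \<sigma>: "tm (ss ! (i - 1)) \<sigma>" "ge_pos \<kappa> \<sigma>" by auto
    from 1 obtain \<mu> where \<mu>: "tm b (Base \<mu>)" by (auto simp: base_tm_def)
    from tm_apps[of "ss ! (i - 1)" ts "Base \<mu>"] \<mu> 1 obtain \<tau>s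
      where \<tau>s: "tm (ss ! (i - 1)) (arrs \<tau>s (Base \<mu>))" "list_all2 tm ts \<tau>s" by auto
    from tm_unique[OF \<sigma>(1) \<tau>s(1)] \<sigma>(2) pos_neg_trans[OF \<kappa>(2)]
    have "ge_pos \<iota> (arrs \<tau>s (Base \<mu>))" by blast
    then have pos: "\<forall>\<tau>\<in>set \<tau>s. gt_neg \<iota> \<tau>" "sort_ge \<iota> \<mu>" by (auto simp: ge_pos_arrs)
    have "computable I t" if t: "t \<in> set ts" for t
    proof -
      from t \<tau>s(2) obtain \<tau> where \<tau>: "\<tau> \<in> set \<tau>s" "tm t \<tau>"
        by (metis in_set_conv_nth list_all2_conv_all_nth)
      from t 1 obtain \<rho> where "comp_at J \<rho> t" by (auto simp: computable_def)
      with tm_unique[OF comp_at_tm \<tau>(2)] have "comp_at J \<tau> t" by blast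
      with pos(1) \<tau>(1) mono(2) have "comp_at I \<tau> t" by blast
      then show ?thesis by (auto simp: computable_def)
    qed
    then have "acc_step I a b" using 1 acc_step.intros[of f ss i ts I] by auto
    with \<mu> pos(2) show ?thesis by (auto simp: small_def)
  qed
  have st: "small b" if "step U a b" "small a" for a b
    using that steps_tm[of U a b] unfolding small_def by blast
  have "SN (\<lambda>a b. step U a b \<or> acc_step J a b) s"
    unfolding SN_def
  proof
    assume "\<exists>q. q 0 = s \<and> (\<forall>i::nat. step U (q i) (q (Suc i)) \<or> acc_step J (q i) (q (Suc i)))"
    then obtain q where q: "q 0 = s"
      "\<And>i::nat. step U (q i) (q (Suc i)) \<or> acc_step J (q i) (q (Suc i))" by blast
    have sm: "small (q i)" for i
    proof (induction i)
      case 0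
      then show ?case using q(1) s by (auto simp: small_def)
    next
      case (Suc i)
      then show ?case using q(2)[of i] st acc by blast
    qed
    then have "\<forall>i. step U (q i) (q (Suc i)) \<or> acc_step I (q i) (q (Suc i))"
      using q(2) acc by blast
    with q(1) s(1) show False by (auto simp: comp_op_def SN_def)
  qed
  moreover have "computable J (ss ! (i - 1))"
    if r: "(step U)\<^sup>*\<^sup>* s (apps (Fun f) ss)" and i: "i \<in> Acc f" for f ss i
  proof -
    from steps_tm[OF r s(2)] have "tm (apps (Fun f) ss) (Base \<kappa>)" .
    from Acc_tm[OF this i] obtain \<sigma> where \<sigma>: "tm (ss ! (i - 1)) \<sigma>" "ge_pos \<kappa> \<sigma>" by blast
    from s(1) r i obtain \<rho> where "comp_at I \<rho> (ss ! (i - 1))"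
      unfolding comp_op_def computable_def by blast
    with tm_unique[OF comp_at_tm \<sigma>(1)] have "comp_at I \<sigma> (ss ! (i - 1))" by blast
    with mono(1) \<sigma>(2) pos_neg_trans[OF s(3)] show ?thesis unfolding computable_def by blast
  qed
  ultimately show ?thesis using s(1) by (auto simp: comp_op_def)
qed

lemma comp_op_fixpoint: "\<exists>I. I = comp_op U I"
proof -
  define cls where "cls \<iota> = {s. \<exists>\<kappa>. sort_ge \<iota> \<kappa> \<and> sort_ge \<kappa> \<iota> \<and> tm s (Base \<kappa>)}" for \<iota>
  define low where "low D \<iota> = {s. \<exists>\<kappa>. sort_gt \<iota> \<kappa> \<and> tm s (Base \<kappa>) \<and> s \<in> D \<kappa>}"
    for D :: "'s \<Rightarrow> ('f, 'v, 'm, 's) mterm set" and \<iota>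
  define G where "G D \<iota> X = comp_op U (low D \<iota> \<union> X \<inter> cls \<iota>) \<inter> cls \<iota>" for D \<iota> X
  define D where "D = wfrec {(\<kappa>, \<iota>). sort_gt \<iota> \<kappa>} (\<lambda>D \<iota>. lfp (G D \<iota>))"
  have wf: "wf {(\<kappa>, \<iota>). sort_gt \<iota> \<kappa>}"
    using sort_wf by (simp add: sort_gt_def wfp_def)
  have D_lfp: "D \<iota> = lfp (G D \<iota>)" for \<iota>
  proof -
    have "low (cut D {(\<kappa>, \<iota>). sort_gt \<iota> \<kappa>} \<iota>) \<iota> = low D \<iota>"
      by (auto simp: low_def cut_def)
    then have "G (cut D {(\<kappa>, \<iota>). sort_gt \<iota> \<kappa>} \<iota>) \<iota> = G D \<iota>"
      by (simp add: G_def fun_eq_iff)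
    then show ?thesis using wfrec[OF wf, of "\<lambda>D \<iota>. lfp (G D \<iota>)" \<iota>] by (simp flip: D_def)
  qed
  have not_cls: "s \<notin> cls \<iota>" if "sort_gt \<iota> \<kappa>" "tm s (Base \<kappa>)" for s \<iota> \<kappa>
    using that tm_unique by (fastforce simp: cls_def sort_gt_def)
  have "mono (G D \<iota>)" for \<iota>
  proof (rule monoI, rule subsetI)
    fix X Y s assume XY: "X \<subseteq> Y" and s: "s \<in> G D \<iota> X"
    from s obtain \<kappa> where \<kappa>: "sort_ge \<iota> \<kappa>" "tm s (Base \<kappa>)" by (auto simp: G_def cls_def)
    have "s \<in> comp_op U (low D \<iota> \<union> Y \<inter> cls \<iota>)"
      by (rule comp_op_mono[of \<iota> _ "low D \<iota> \<union> X \<inter> cls \<iota>" s U \<kappa>])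
        (use s \<kappa> XY not_cls in \<open>auto simp: G_def\<close>)
    with s show "s \<in> G D \<iota> Y" by (auto simp: G_def)
  qed
  then have D_unfold: "D \<iota> = G D \<iota> (D \<iota>)" for \<iota>
    unfolding D_lfp[of \<iota>] by (rule lfp_unfold)
  have D_eq: "D \<iota> = D \<kappa>" if "sort_ge \<iota> \<kappa>" "sort_ge \<kappa> \<iota>" for \<iota> \<kappa>
  proof -
    have "sort_gt \<iota> = sort_gt \<kappa>" using that sort_gt_trans by blast
    then have "low D \<iota> = low D \<kappa>" by (simp add: low_def)
    moreover have "cls \<iota> = cls \<kappa>" using that sort_trans unfolding cls_def by blast
    ultimately have "G D \<iota> = G D \<kappa>" by (simp add: G_def fun_eq_iff)
    then show ?thesis by (simp add: D_lfp[of \<iota>] D_lfp[of \<kappa>])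
  qed
  define I where "I = {s. \<exists>\<kappa>. tm s (Base \<kappa>) \<and> s \<in> D \<kappa>}"
  have I_D: "s \<in> I \<longleftrightarrow> s \<in> D \<kappa>" if "tm s (Base \<kappa>)" for s \<kappa>
    using that tm_unique unfolding I_def by blast
  have I_loc: "s \<in> I \<longleftrightarrow> s \<in> low D \<iota> \<union> D \<iota> \<inter> cls \<iota>"
    if s: "tm s (Base \<kappa>)" "sort_ge \<iota> \<kappa>" for s \<iota> \<kappa>
  proof (cases "sort_ge \<kappa> \<iota>")
    case True
    then have "s \<in> cls \<iota>" using s by (auto simp: cls_def)
    moreover from this have "s \<notin> low D \<iota>" using not_cls by (auto simp: low_def)
    ultimately show ?thesis using I_D[OF s(1)] D_eq[OF s(2) True] by auto
  next
    case False
    then have gt: "sort_gt \<iota> \<kappa>" using s by (auto simp: sort_gt_def)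
    have "s \<in> low D \<iota> \<longleftrightarrow> s \<in> D \<kappa>"
      using gt s(1) tm_unique unfolding low_def by blast
    then show ?thesis using not_cls[OF gt s(1)] I_D[OF s(1)] by auto
  qed
  have "s \<in> I \<longleftrightarrow> s \<in> comp_op U I" if s: "tm s (Base \<iota>)" for s \<iota>
  proof -
    let ?J = "low D \<iota> \<union> D \<iota> \<inter> cls \<iota>"
    have "s \<in> cls \<iota>" using s sort_refl by (auto simp: cls_def)
    then have "s \<in> D \<iota> \<longleftrightarrow> s \<in> comp_op U ?J" by (subst D_unfold) (auto simp: G_def)
    moreover have "s \<in> comp_op U ?J \<longleftrightarrow> s \<in> comp_op U I"
    proof
      assume "s \<in> comp_op U ?J"
      then show "s \<in> comp_op U I"
        by (rule comp_op_mono[of \<iota> I ?J, rotated 2])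
          (use s sort_refl I_loc in \<open>auto simp: sort_gt_def\<close>)
    next
      assume "s \<in> comp_op U I"
      then show "s \<in> comp_op U ?J"
        by (rule comp_op_mono[of \<iota> ?J I, rotated 2])
          (use s sort_refl I_loc in \<open>auto simp: sort_gt_def\<close>)
    qed
    ultimately show ?thesis using I_D[OF s] by simp
  qed
  moreover have "\<exists>\<iota>. tm s (Base \<iota>)" if "s \<in> I \<union> comp_op U I" for s
    using that by (auto simp: I_def comp_op_def base_tm_def)
  ultimately have "I = comp_op U I" by blast
  then show ?thesis by blast
qed

lemma hd_of_apps [simp]: "hd_of (apps h ts) = hd_of h"
  by (induction ts arbitrary: h) auto

lemma comp_op_RC_set:
  assumes "I = comp_op U I"
  shows "RC_set U I"
proof -
  let ?r = "\<lambda>a b. step U a b \<or> acc_step I a b"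
  have in_I: "s \<in> I \<longleftrightarrow> s \<in> comp_op U I" for s
    using assms by blast
  have sub: "SN ?r s" "base_tm s" if "s \<in> I" for s
    using iffD1[OF in_I that] by (auto simp: comp_op_def)
  have sn: "SN (step U) s" if "s \<in> I" for s
    using sub(1)[OF that] unfolding SN_def by blast
  have cl: "t \<in> I" if "s \<in> I" "step U s t" for s t
  proof -
    have "base_tm t"
      using that sub(2) steps_tm[of U s t] unfolding base_tm_def by blast
    moreover have "SN ?r t"
      unfolding SN_def
    proof
      assume "\<exists>q. q 0 = t \<and> (\<forall>i. ?r (q i) (q (Suc i)))"
      then obtain q where q: "q 0 = t" "\<And>i. ?r (q i) (q (Suc i))" by blast
      have "?r ((case_nat s q) i) ((case_nat s q) (Suc i))" for i
        using q that(2) by (cases i) auto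
      then have "\<exists>p. p 0 = s \<and> (\<forall>i. ?r (p i) (p (Suc i)))"
        by (intro exI[of _ "case_nat s q"]) simp
      then show False using sub(1)[OF that(1)] unfolding SN_def by contradiction
    qed
    moreover have "computable I (ss ! (i - 1))"
      if r: "(step U)\<^sup>*\<^sup>* t (apps (Fun f) ss)" "i \<in> Acc f" for f ss i
    proof -
      have "(step U)\<^sup>*\<^sup>* s (apps (Fun f) ss)"
        using r(1) \<open>step U s t\<close> by (rule converse_rtranclp_into_rtranclp[rotated])
      moreover have "s \<in> comp_op U I" using \<open>s \<in> I\<close> by (rule iffD1[OF in_I])
      ultimately show ?thesis using r(2) unfolding comp_op_def by blast
    qed
    ultimately have "t \<in> comp_op U I" by (auto simp: comp_op_def)
    then show ?thesis by (rule iffD2[OF in_I])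
  qed
  have neutral: "s \<in> I"
    if s: "base_tm s" "\<And>t. step U s t \<Longrightarrow> t \<in> I" and h: "\<And>f. hd_of s \<noteq> Fun f" for s
  proof -
    have no: "\<not> acc_step I s t" for t
    proof
      assume "acc_step I s t"
      then obtain f ss where "s = apps (Fun f) ss" by cases blast
      then show False using h[of f] by simp
    qed
    have "SN ?r s"
      unfolding SN_def
    proof
      assume "\<exists>q. q 0 = s \<and> (\<forall>i. ?r (q i) (q (Suc i)))"
      then obtain q where q: "q 0 = s" "\<And>i. ?r (q i) (q (Suc i))" by blast
      from q(2)[of 0] q(1) no s(2) have "q 1 \<in> I" by auto
      then have "SN ?r (q 1)" using sub(1) by blast
      moreover have "\<exists>p. p 0 = q 1 \<and> (\<forall>i. ?r (p i) (p (Suc i)))"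
        by (rule exI[of _ "\<lambda>i. q (Suc i)"]) (simp add: q(2))
      ultimately show False unfolding SN_def by contradiction
    qed
    moreover have "computable I (ss ! (i - 1))"
      if r: "(step U)\<^sup>*\<^sup>* s (apps (Fun f) ss)" "i \<in> Acc f" for f ss i
      using r(1)
    proof (cases rule: converse_rtranclpE)
      case base
      then show ?thesis using h[of f] by simp
    next
      case (step t)
      then have "t \<in> comp_op U I" using s(2) iffD1[OF in_I] by blast
      then show ?thesis using step(2) r(2) unfolding comp_op_def by blast
    qed
    ultimately have "s \<in> comp_op U I" using s(1) by (auto simp: comp_op_def)
    then show ?thesis by (rule iffD2[OF in_I])
  qed
  show ?thesis
    unfolding RC_set_def
  proof (intro conjI allI impI ballI; (elim conjE)?)
    show "apps (Var x) ss \<in> I"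
      if "base_tm (apps (Var x) ss)" "\<forall>t. step U (apps (Var x) ss) t \<longrightarrow> t \<in> I" for x ss
      by (rule neutral) (use that in auto)
    show "apps (Abs \<sigma> u) (s\<^sub>0 # ss) \<in> I"
      if "base_tm (apps (Abs \<sigma> u) (s\<^sub>0 # ss))"
        "\<forall>t. step U (apps (Abs \<sigma> u) (s\<^sub>0 # ss)) t \<longrightarrow> t \<in> I" for \<sigma> u s\<^sub>0 ss
      by (rule neutral) (use that in auto)
  qed (fact sub sn cl)+
qed

lemma C_of_spec: "RC_set U (C_of U) \<and> C_of U = comp_op U (C_of U)"
proof -
  have "\<exists>I. RC_set U I \<and> I = comp_op U I"
    using comp_op_fixpoint[of U] comp_op_RC_set[of _ U] by blast
  then show ?thesis unfolding C_of_def by (rule someI_ex)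
qed

end

end

theory Submission
  imports Defs
begin

text \<open>Along an infinite chain, consider the projected terms \<open>nu_bar \<nu> (t i)\<close>. Each of them
  rewrites to the projection of \<open>s (i + 1)\<close>, which has the next projected term as a subterm, and
  as a strict one whenever the pair used lies in \<open>P\<^sub>1\<close>. The first projected term is terminating:
  it is a strict subterm of \<open>t 0\<close>, or it is computable. A terminating term is also terminating
  for the union of rewriting and the strict subterm relation, because a rewrite step in a subterm
  is a rewrite step of the whole term. So pairs in \<open>P\<^sub>1\<close> are used only finitely often, and a tail
  of the chain is a chain over \<open>P\<^sub>2\<close> with the same flags.\<close>

section \<open>Termination of single elements\<close>

lemma SN_step: "SN r x \<Longrightarrow> r x y \<Longrightarrow> SN r y"
  unfolding SN_def
proof (rule notI, elim exE conjE)
  fix q assume n: "\<not> (\<exists>q. q 0 = x \<and> (\<forall>i. r (q i) (q (Suc i))))"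
    and xy: "r x y" and q: "q 0 = y" "\<forall>i. r (q i) (q (Suc i))"
  have "r (case_nat x q i) (case_nat x q (Suc i))" for i
    using q xy by (cases i) auto
  then have "\<exists>q. q 0 = x \<and> (\<forall>i. r (q i) (q (Suc i)))"
    by (intro exI[of _ "case_nat x q"]) simp
  with n show False by contradiction
qed

lemma SN_I:
  assumes "\<And>y. r x y \<Longrightarrow> SN r y"
  shows "SN r x"
  unfolding SN_def
proof
  assume "\<exists>q. q 0 = x \<and> (\<forall>i. r (q i) (q (Suc i)))"
  then obtain q where q: "q 0 = x" "\<And>i. r (q i) (q (Suc i))" by blast
  have "SN r (q 1)" using assms[of "q 1"] q(1) q(2)[of 0] by simp
  moreover have "\<exists>p. p 0 = q 1 \<and> (\<forall>i. r (p i) (p (Suc i)))"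
    by (rule exI[of _ "\<lambda>i. q (Suc i)"]) (simp add: q(2))
  ultimately show False unfolding SN_def by contradiction
qed

text \<open>\<open>SN\<close> speaks of infinite sequences from one element, so induction comes from
  dependent choice: every counterexample has a successor that is again one, which would give an
  infinite sequence.\<close>

lemma SN_induct [consumes 1, case_names step]:
  assumes "SN r s" and step: "\<And>x. SN r x \<Longrightarrow> (\<And>y. r x y \<Longrightarrow> P y) \<Longrightarrow> P x"
  shows "P s"
proof (rule ccontr)
  assume "\<not> P s"
  have "\<exists>q. q 0 = s \<and> (\<forall>i. r (q i) (q (Suc i)))"
  proof -
    have "\<exists>q. \<forall>n. (SN r (q n) \<and> \<not> P (q n) \<and> (n = 0 \<longrightarrow> q n = s)) \<and> r (q n) (q (Suc n))"
    proof (rule dependent_nat_choice)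
      show "\<exists>x. SN r x \<and> \<not> P x \<and> ((0::nat) = 0 \<longrightarrow> x = s)"
        using assms(1) \<open>\<not> P s\<close> by blast
    next
      fix x and n :: nat
      assume "SN r x \<and> \<not> P x \<and> (n = 0 \<longrightarrow> x = s)"
      then show "\<exists>y. (SN r y \<and> \<not> P y \<and> (Suc n = 0 \<longrightarrow> y = s)) \<and> r x y"
        using step[of x] SN_step[of r x] by blast
    qed
    then show ?thesis by blast
  qed
  with assms(1) show False unfolding SN_def by contradiction
qed

lemma SN_mono: "SN r s \<Longrightarrow> (\<And>a b. q a b \<Longrightarrow> r a b) \<Longrightarrow> SN q s"
  unfolding SN_def by blast

text \<open>The first \<open>r\<close>-step leads to some \<open>z\<close> to which the induction
  hypothesis applies, and the target is \<open>z\<close> itself or a proper successor of it.\<close>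

lemma SN_tranclp: "SN r s \<Longrightarrow> SN r\<^sup>+\<^sup>+ s"
proof (induction rule: SN_induct)
  case (step x)
  show ?case
  proof (rule SN_I)
    fix y assume "r\<^sup>+\<^sup>+ x y"
    then obtain z where z: "r x z" "r\<^sup>*\<^sup>* z y" by (metis tranclpD)
    from step(2)[OF z(1)] z(2) show "SN r\<^sup>+\<^sup>+ y"
      using SN_step[of "r\<^sup>+\<^sup>+" z y] by (auto dest: rtranclpD)
  qed
qed

text \<open>Induction on the first element along \<open>r\<^sup>+\<^sup>+\<close>: if the step from
  \<open>a i\<close> is strict, then \<open>a (Suc i)\<close> is a proper successor of
  \<open>a 0\<close>, so the tail that starts there contains only finitely many strict
  steps.\<close>

lemma SN_eventually_not_tranclp:
  assumes "SN r (a 0)" "\<And>i::nat. r\<^sup>*\<^sup>* (a i) (a (Suc i))"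
  shows "\<exists>N. \<forall>i\<ge>N. \<not> r\<^sup>+\<^sup>+ (a i) (a (Suc i))"
proof -
  \<comment> \<open>The sequence is quantified inside the induction, since the hypothesis is applied
    to a tail.\<close>
  have "\<forall>a. a 0 = s \<longrightarrow> (\<forall>i::nat. r\<^sup>*\<^sup>* (a i) (a (Suc i))) \<longrightarrow>
      (\<exists>N. \<forall>i\<ge>N. \<not> r\<^sup>+\<^sup>+ (a i) (a (Suc i)))" if "SN r\<^sup>+\<^sup>+ s" for s
    using that
  proof (induction rule: SN_induct)
    case (step x)
    show ?case
    proof (intro allI impI, rule ccontr)
      fix a :: "nat \<Rightarrow> 'a"
      assume a: "a 0 = x" "\<forall>i. r\<^sup>*\<^sup>* (a i) (a (Suc i))"
        and no: "\<not> (\<exists>N. \<forall>i\<ge>N. \<not> r\<^sup>+\<^sup>+ (a i) (a (Suc i)))"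
      from no obtain i where i: "r\<^sup>+\<^sup>+ (a i) (a (Suc i))" by blast
      have "r\<^sup>*\<^sup>* (a 0) (a j)" for j
        by (induction j) (use a(2) in \<open>auto intro: rtranclp_trans\<close>)
      with i a(1) have "r\<^sup>+\<^sup>+ x (a (Suc i))"
        by (metis rtranclp_tranclp_tranclp)
      then have "\<exists>N. \<forall>j\<ge>N. \<not> r\<^sup>+\<^sup>+ (a (j + Suc i)) (a (Suc j + Suc i))"
        using spec[OF step(2)[of "a (Suc i)"], of "\<lambda>j. a (j + Suc i)"] a(2) by simp
      then obtain N where N: "\<And>j. j \<ge> N \<Longrightarrow> \<not> r\<^sup>+\<^sup>+ (a (j + Suc i)) (a (Suc j + Suc i))" by blast
      have "\<not> r\<^sup>+\<^sup>+ (a k) (a (Suc k))" if "k \<ge> N + Suc i" for k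
        using N[of "k - Suc i"] that by simp
      with no show False by blast
    qed
  qed
  from this[OF SN_tranclp[OF assms(1)]] assms(2) show ?thesis by blast
qed

section \<open>Instantiation of indices by variables\<close>

lemma finite_FV: "finite (FV s)"
  by (induction s) auto

lemma finite_FMV: "finite (FMV s)"
  by (induction s) auto

lemma FV_lift [simp]: "FV (lift d k s) = FV s"
  by (induction s arbitrary: k) auto

lemma FV_inst: "FV (inst k us s) \<subseteq> FV s \<union> (\<Union>u\<in>set us. FV u)"
proof (induction s arbitrary: k)
  case (Bnd i)
  have "us ! (i - k) \<in> set us" if "\<not> i < k" "i < k + length us"
    by (rule nth_mem) (use that in simp)
  then show ?case by (auto intro!: bexI[of _ "us ! (i - k)"])
next
  case (MApp Z ss)
  then show ?case unfolding inst.simps FV.simps set_map by blast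
qed (simp; blast)+

lemma FMV_inst_Var [simp]: "FMV (inst k [Var x] s) = FMV s"
  by (induction s arbitrary: k) auto

lemma size_inst_Var [simp]: "size (inst k [Var x] s) = size s"
proof (induction s arbitrary: k)
  case (MApp Z ss)
  then show ?case by (simp add: size_list_conv_sum_list comp_def cong: map_cong)
qed auto

lemma FV_bind_var [simp]: "FV (bind_var k x s) = FV s - {x}"
  by (induction s arbitrary: k) auto

lemma FMV_bind_var [simp]: "FMV (bind_var k x s) = FMV s"
  by (induction s arbitrary: k) auto

lemma inst_bind_var [simp]: "inst k [Var x] (bind_var k x s) = s"
  by (induction s arbitrary: k) (auto intro: map_idI)

lemma inst_apps: "inst k us (apps s ts) = apps (inst k us s) (map (inst k us) ts)"
  by (induction ts arbitrary: s) auto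

lemma FV_apps: "FV (apps s ts) = FV s \<union> (\<Union>t\<in>set ts. FV t)"
  by (induction ts arbitrary: s) auto

text \<open>Lifting by \<open>j\<close> moves index \<open>k + c\<close> to
  \<open>j + k + c\<close>, and \<open>Var y\<close> is invariant under lifting. The offset
  \<open>c\<close> counts the binders crossed by the induction.\<close>

lemma inst_lift_Var:
  "inst (j + k + c) [Var y] (lift j c u) = lift j c (inst (k + c) [Var y] u)"
proof (induction u arbitrary: c)
  case (Abs \<sigma> u)
  from Abs[of "Suc c"] show ?case by simp
qed auto

text \<open>By the bound on \<open>loose u\<close>, all indices from \<open>j\<close> on are
  replaced by \<open>us\<close>. Afterwards index \<open>j + k\<close> can only come from an
  inserted term, where it is index \<open>k\<close> lifted by \<open>j\<close>.\<close>

lemma inst_inst_Var: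
  "loose u \<subseteq> {..<j + length us} \<Longrightarrow>
   inst (j + k) [Var y] (inst j us u) = inst j (map (inst k [Var y]) us) u"
proof (induction u arbitrary: j)
  case (Bnd i)
  then show ?case using inst_lift_Var[of j k 0 y] by auto
next
  case (Abs \<sigma> u)
  have "loose u \<subseteq> {..<Suc j + length us}"
  proof
    fix i assume "i \<in> loose u"
    then show "i \<in> {..<Suc j + length us}" using Abs.prems by (cases i) auto
  qed
  from Abs.IH[OF this] show ?case by simp
qed (auto simp: subset_iff)

section \<open>Meta-variable substitution\<close>

lemma loose_strip_lams: "n \<le> lam_count t \<Longrightarrow> loose t \<subseteq> {..<m} \<Longrightarrow> loose (strip_lams n t) \<subseteq> {..<m + n}"
proof (induction n t arbitrary: m rule: strip_lams.induct)
  case (1 n \<sigma> s)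
  have "loose s \<subseteq> {..<Suc m}"
  proof
    fix i assume "i \<in> loose s"
    then show "i \<in> {..<Suc m}" using 1(3) by (cases i) auto
  qed
  from 1(1)[OF _ this] 1(2) show ?case by simp
qed auto

lemma FV_strip_lams [simp]: "FV (strip_lams n t) = FV t"
  by (induction n t rule: strip_lams.induct) auto

text \<open>The only dangling indices of the stripped body are those replaced by arguments, so
  opening an outer binder affects the arguments alone. The number of stripped abstractions is the
  same on both sides.\<close>

lemma meta_app_inst_Var:
  assumes "loose t = {}"
  shows "meta_app t (map (inst k [Var y]) ss) = inst k [Var y] (meta_app t ss)"
proof -
  let ?n = "min (length ss) (lam_count t)"
  have "loose (strip_lams ?n t) \<subseteq> {..<0 + length (rev (take ?n ss))}"
    using loose_strip_lams[of ?n t 0] assms by simp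
  from inst_inst_Var[OF this, of k y] show ?thesis
    by (simp add: meta_app_def Let_def inst_apps take_map drop_map rev_map)
qed

lemma FV_meta_app: "FV (meta_app t ss) \<subseteq> FV t \<union> (\<Union>s\<in>set ss. FV s)"
proof -
  let ?n = "min (length ss) (lam_count t)"
  have "FV (inst 0 (rev (take ?n ss)) (strip_lams ?n t)) \<subseteq> FV t \<union> (\<Union>s\<in>set ss. FV s)"
    using FV_inst[of 0 "rev (take ?n ss)" "strip_lams ?n t"] set_take_subset[of ?n ss] by auto
  then show ?thesis
    using set_drop_subset[of ?n ss] unfolding meta_app_def Let_def FV_apps by blast
qed

lemma FV_msubst: "FV (msubst \<gamma> s) \<subseteq> FV s \<union> (\<Union>t\<in>ran \<gamma>. FV t)"
proof (induction s)
  case (MApp Z ss)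
  show ?case
  proof (cases "\<gamma> Z")
    case None
    with MApp show ?thesis by fastforce
  next
    case (Some t)
    then have "t \<in> ran \<gamma>" by (rule ranI)
    with MApp Some FV_meta_app[of t "map (msubst \<gamma>) ss"] show ?thesis by fastforce
  qed
qed auto

text \<open>Lets a substitution pass an opened binder: its values have no dangling index that the
  opening could hit.\<close>

lemma msubst_inst_Var:
  assumes "\<And>t. t \<in> ran \<gamma> \<Longrightarrow> loose t = {}"
  shows "msubst \<gamma> (inst k [Var y] s) = inst k [Var y] (msubst \<gamma> s)"
proof (induction s arbitrary: k)
  case (MApp Z ss)
  then have "map (msubst \<gamma>) (map (inst k [Var y]) ss) = map (inst k [Var y]) (map (msubst \<gamma>) ss)"
    by simp
  then show ?case
    using assms by (auto split: option.split simp: meta_app_inst_Var ranI simp del: map_map)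
qed auto

lemma msubst_apps: "msubst \<gamma> (apps s ts) = apps (msubst \<gamma> s) (map (msubst \<gamma>) ts)"
  by (induction ts arbitrary: s) auto

section \<open>Renaming of free variables\<close>

fun ren :: "('v \<Rightarrow> 'v) \<Rightarrow> ('f, 'v, 'm, 's) mterm \<Rightarrow> ('f, 'v, 'm, 's) mterm" where
  "ren \<pi> (Bnd i) = Bnd i"
| "ren \<pi> (Var x) = Var (\<pi> x)"
| "ren \<pi> (Fun f) = Fun f"
| "ren \<pi> (App s t) = App (ren \<pi> s) (ren \<pi> t)"
| "ren \<pi> (Abs \<sigma> s) = Abs \<sigma> (ren \<pi> s)"
| "ren \<pi> (MApp Z ss) = MApp Z (map (ren \<pi>) ss)"

lemma ren_cong: "(\<And>x. x \<in> FV s \<Longrightarrow> \<pi> x = \<rho> x) \<Longrightarrow> ren \<pi> s = ren \<rho> s"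
  by (induction s) auto

lemma ren_closed: "FV s = {} \<Longrightarrow> ren \<pi> s = s"
  by (induction s) (auto intro: map_idI)

text \<open>Bound variables are indices, so nothing is captured, and \<open>\<pi>\<close> may be any
  map, injective or not.\<close>

lemma ren_inst_Var: "ren \<pi> (inst k [Var x] s) = inst k [Var (\<pi> x)] (ren \<pi> s)"
  by (induction s arbitrary: k) auto

context static_dp
begin

section \<open>Projections\<close>

lemma args_of_apps [simp]: "args_of (apps s ts) = args_of s @ ts"
  by (induction ts arbitrary: s) auto

lemma nu_bar_apps: "nu_bar \<nu> (apps (Fun f) ts) = ts ! (\<nu> f - 1)"
  by (simp add: nu_bar_def hd_of_apps)

lemma nu_bar_defined_apps:
  "nu_bar_defined \<nu> (apps (Fun f) ts) \<longleftrightarrow> 1 \<le> \<nu> f \<and> \<nu> f \<le> length ts"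
  by (simp add: nu_bar_defined_def hd_of_apps)

lemma nu_bar_msubst:
  "nu_bar_defined \<nu> (apps (Fun f) ts) \<Longrightarrow>
   nu_bar \<nu> (msubst \<gamma> (apps (Fun f) ts)) = msubst \<gamma> (nu_bar \<nu> (apps (Fun f) ts))"
  unfolding msubst_apps msubst.simps nu_bar_apps nu_bar_defined_apps by auto

lemma nu_bar_mem: "nu_bar_defined \<nu> (apps (Fun f) ts) \<Longrightarrow> nu_bar \<nu> (apps (Fun f) ts) \<in> set ts"
  unfolding nu_bar_apps nu_bar_defined_apps by (auto intro!: nth_mem)

section \<open>Subterms\<close>

lemma subterm_refl: "s \<unrhd> s"
  by (rule strict_subterm_subterm.intros)

lemma subterm_iff: "s \<unrhd> t \<longleftrightarrow> s = t \<or> s \<rhd> t"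
  by (metis subterm.cases strict_subterm_subterm.intros(1,2))

lemma subterm_trans:
  "s \<rhd> t \<Longrightarrow> t \<unrhd> u \<Longrightarrow> s \<rhd> u"
  "s \<unrhd> t \<Longrightarrow> t \<unrhd> u \<Longrightarrow> s \<unrhd> u"
  by (induction rule: strict_subterm_subterm.inducts)
    (auto intro: strict_subterm_subterm.intros)

text \<open>Opening a binder with a variable keeps the size, hence each subterm step loses at least
  one constructor.\<close>

lemma subterm_size:
  "s \<rhd> t \<Longrightarrow> size t < size s"
  "s \<unrhd> t \<Longrightarrow> size t \<le> size s"
  by (induction rule: strict_subterm_subterm.inducts) auto

lemma apps_strict_subterm: "s \<in> set ss \<Longrightarrow> s \<unrhd> t \<Longrightarrow> apps h ss \<rhd> t"
proof (induction ss rule: rev_induct)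
  case (snoc u ss)
  then show ?case by (auto intro: strict_subterm_subterm.intros)
qed simp

lemma typed_loose: "typed \<Gamma> s \<sigma> \<Longrightarrow> loose s \<subseteq> {..<length \<Gamma>}"
proof (induction rule: typed.induct)
  case (6 Z \<sigma>s \<tau> \<Gamma> ss)
  then show ?case by (auto simp: list_all2_conv_all_nth in_set_conv_nth) blast
qed auto

lemma is_sub_loose: "is_sub \<gamma> \<Longrightarrow> t \<in> ran \<gamma> \<Longrightarrow> loose t = {}"
  using typed_loose[of "[]"] by (fastforce simp: is_sub_def tm_def ran_def)

text \<open>The variable that instantiates a binder in \<open>s \<unrhd> t\<close> may occur in \<open>\<gamma>\<close>, so it has to be
  renamed; this affects the free variables of \<open>t\<close>.\<close>

lemma subterm_msubst_ren:
  fixes s t :: "('f, 'v, 'm, 's) mterm"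
  assumes sub: "is_sub \<gamma>" and fin: "finite (dom \<gamma>)"
  shows "s \<rhd> t \<Longrightarrow> \<exists>\<rho>. msubst \<gamma> (ren \<pi> s) \<rhd> msubst \<gamma> (ren \<rho> t)"
    and "s \<unrhd> t \<Longrightarrow> \<exists>\<rho>. msubst \<gamma> (ren \<pi> s) \<unrhd> msubst \<gamma> (ren \<rho> t)"
proof (induction arbitrary: \<pi> and \<pi> rule: strict_subterm_subterm.inducts)
  case (3 x \<sigma> s t)
  \<comment> \<open>The new variable has to avoid the values of \<open>\<gamma>\<close> too, because
    these end up under the binder that is being opened.\<close>
  let ?X = "FV (ren \<pi> s) \<union> (\<Union>t\<in>ran \<gamma>. FV t)"
  have "finite ?X" using finite_ran[OF fin] by (simp add: finite_FV)
  with inf_vars[of \<sigma>] obtain y where y: "vty y = \<sigma>" "y \<notin> ?X"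
    by (metis (mono_tags, lifting) finite_subset mem_Collect_eq subsetI)
  have "ren (\<pi>(x := y)) s = ren \<pi> s" by (rule ren_cong) (use 3(4) in auto)
  then have eq: "msubst \<gamma> (ren (\<pi>(x := y)) (subst0 s (Var x))) = subst0 (msubst \<gamma> (ren \<pi> s)) (Var y)"
    using is_sub_loose[OF sub] by (simp add: ren_inst_Var msubst_inst_Var del: fun_upd_apply) simp
  \<comment> \<open>The given opening used \<open>x\<close>; redirecting \<open>x\<close> to
    \<open>y\<close> turns it into an opening with the fresh variable.\<close>
  from 3(3)[of "\<pi>(x := y)"] obtain \<rho>
    where \<rho>: "subst0 (msubst \<gamma> (ren \<pi> s)) (Var y) \<unrhd> msubst \<gamma> (ren \<rho> t)"
    unfolding eq by blast
  have "y \<notin> FV (msubst \<gamma> (ren \<pi> s))" using y(2) FV_msubst[of \<gamma> "ren \<pi> s"] by blast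
  from strict_subterm_subterm.intros(3)[OF y(1) this \<rho>] show ?case by auto
next
  case (1 s)
  show ?case using strict_subterm_subterm.intros(1) by blast
next
  case (2 s t)
  from 2(2)[of \<pi>] show ?case using strict_subterm_subterm.intros(2) by blast
next
  case (4 s\<^sub>1 t s\<^sub>2)
  from 4(2)[of \<pi>] obtain \<rho> where "msubst \<gamma> (ren \<pi> s\<^sub>1) \<unrhd> msubst \<gamma> (ren \<rho> t)" by blast
  from strict_subterm_subterm.intros(4)[OF this] show ?case by auto
next
  case (5 s\<^sub>2 t s\<^sub>1)
  from 5(2)[of \<pi>] obtain \<rho> where "msubst \<gamma> (ren \<pi> s\<^sub>2) \<unrhd> msubst \<gamma> (ren \<rho> t)" by blast
  from strict_subterm_subterm.intros(5)[OF this] show ?case by auto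
qed

text \<open>On closed meta-terms every renaming is the identity, so the unknown one in the general
  statement disappears.\<close>

lemma strict_subterm_msubst:
  assumes "is_sub \<gamma>" "finite (dom \<gamma>)" "s \<rhd> t" "FV s = {}" "FV t = {}"
  shows "msubst \<gamma> s \<rhd> msubst \<gamma> t"
  using subterm_msubst_ren(1)[OF assms(1-3)] by (metis assms(4,5) ren_closed)

section \<open>Typing when a binder is closed or opened\<close>

lemma typed_bind_var:
  "typed \<Gamma> s \<tau> \<Longrightarrow> \<Gamma> = \<Gamma>\<^sub>1 @ \<Gamma>\<^sub>2 \<Longrightarrow> vty x = \<sigma>
    \<Longrightarrow> typed (\<Gamma>\<^sub>1 @ \<sigma> # \<Gamma>\<^sub>2) (bind_var (length \<Gamma>\<^sub>1) x s) \<tau>"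
proof (induction arbitrary: \<Gamma>\<^sub>1 rule: typed.induct)
  case (1 i \<Gamma>)
  then show ?case
    using typed.intros(1)[of i "\<Gamma>\<^sub>1 @ \<sigma> # \<Gamma>\<^sub>2"] typed.intros(1)[of "Suc i" "\<Gamma>\<^sub>1 @ \<sigma> # \<Gamma>\<^sub>2"]
    by (auto simp: nth_append Suc_diff_le)
next
  case (2 \<Gamma> y)
  then show ?case
    using typed.intros(1)[of "length \<Gamma>\<^sub>1" "\<Gamma>\<^sub>1 @ \<sigma> # \<Gamma>\<^sub>2"] by (auto intro: typed.intros)
next
  case (5 \<sigma>' \<Gamma> s \<tau>)
  from 5(2)[of "\<sigma>' # \<Gamma>\<^sub>1"] 5(3,4) show ?case by (auto intro: typed.intros)
next
  case (6 Z \<sigma>s \<tau> \<Gamma> ss)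
  then show ?case by (auto intro!: typed.intros(6)[of Z \<sigma>s] simp: list_all2_conv_all_nth)
qed (auto intro: typed.intros)

text \<open>Opening removes from the context the entry that closing inserts. The entry sits behind
  \<open>\<Gamma>\<^sub>1\<close> so that the induction can pass further binders.\<close>

lemma typed_inst_Var:
  "typed \<Gamma> s \<tau> \<Longrightarrow> \<Gamma> = \<Gamma>\<^sub>1 @ \<sigma> # \<Gamma>\<^sub>2 \<Longrightarrow> vty x = \<sigma>
    \<Longrightarrow> typed (\<Gamma>\<^sub>1 @ \<Gamma>\<^sub>2) (inst (length \<Gamma>\<^sub>1) [Var x] s) \<tau>"
proof (induction arbitrary: \<Gamma>\<^sub>1 rule: typed.induct)
  case (1 i \<Gamma>)
  show ?case
  proof (cases i "length \<Gamma>\<^sub>1" rule: linorder_cases)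
    case less
    then show ?thesis
      using 1 typed.intros(1)[of i "\<Gamma>\<^sub>1 @ \<Gamma>\<^sub>2"] by (simp add: nth_append)
  next
    case equal
    then show ?thesis using 1 typed.intros(2)[of "\<Gamma>\<^sub>1 @ \<Gamma>\<^sub>2" x] by simp
  next
    case greater
    then obtain n where "i = Suc (length \<Gamma>\<^sub>1 + n)" using less_imp_Suc_add by blast
    then show ?thesis
      using 1 typed.intros(1)[of "length \<Gamma>\<^sub>1 + n" "\<Gamma>\<^sub>1 @ \<Gamma>\<^sub>2"] by (simp add: nth_append)
  qed
next
  case (5 \<sigma>' \<Gamma> s \<tau>)
  from 5(2)[of "\<sigma>' # \<Gamma>\<^sub>1"] 5(3,4) show ?case by (auto intro: typed.intros)
next
  case (6 Z \<sigma>s \<tau> \<Gamma> ss)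
  then show ?case by (auto intro!: typed.intros(6)[of Z \<sigma>s] simp: list_all2_conv_all_nth)
qed (auto intro: typed.intros)

lemma tm_Abs: "tm (Abs \<sigma> s) \<tau> \<Longrightarrow> \<exists>\<rho>. \<tau> = \<sigma> \<rightarrow>\<^sub>t \<rho> \<and> typed [\<sigma>] s \<rho> \<and> FMV s = {}"
  unfolding tm_def by (erule conjE, cases rule: typed.cases) auto

lemma tm_AppI: "tm s (\<sigma> \<rightarrow>\<^sub>t \<tau>) \<Longrightarrow> tm t \<sigma> \<Longrightarrow> tm (App s t) \<tau>"
  by (auto simp: tm_def intro: typed.intros)

lemma step_tm: "step R s t \<Longrightarrow> tm s \<sigma> \<Longrightarrow> tm t \<sigma>"
  using steps_tm[of R s t] by blast

lemma step_App1: "step R s s' \<Longrightarrow> tm (App s t) \<tau> \<Longrightarrow> step R (App s t) (App s' t)"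
  using tm_App[of s t \<tau>] step_tm[of R s s'] tm_AppI[of s' _ \<tau> t]
  by (auto simp: step_def intro: rewr.intros)

lemma step_App2: "step R t t' \<Longrightarrow> tm (App s t) \<tau> \<Longrightarrow> step R (App s t) (App s t')"
  using tm_App[of s t \<tau>] step_tm[of R t t'] tm_AppI[of s _ \<tau> t']
  by (auto simp: step_def intro: rewr.intros)

text \<open>Rewriting is closed under contexts, so the step on \<open>t\<close> can be performed at
  its position inside \<open>s\<close>.\<close>

lemma subterm_step:
  "s \<rhd> t \<Longrightarrow> tm s \<sigma> \<Longrightarrow> step R t t' \<Longrightarrow> \<exists>s'. step R s s' \<and> s' \<unrhd> t'"
  "s \<unrhd> t \<Longrightarrow> tm s \<sigma> \<Longrightarrow> step R t t' \<Longrightarrow> \<exists>s'. step R s s' \<and> s' \<unrhd> t'"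
proof (induction arbitrary: \<sigma> and \<sigma> rule: strict_subterm_subterm.inducts)
  case (3 x \<tau> s t)
  from tm_Abs[OF 3(5)] obtain \<rho> where \<rho>: "\<sigma> = \<tau> \<rightarrow>\<^sub>t \<rho>" "typed [\<tau>] s \<rho>" "FMV s = {}" by blast
  then have sx: "tm (subst0 s (Var x)) \<rho>"
    using typed_inst_Var[of "[\<tau>]" s \<rho> "[]" \<tau> "[]" x] 3(1) by (simp add: tm_def)
  from 3(3)[OF this 3(6)] obtain w where w: "step R (subst0 s (Var x)) w" "w \<unrhd> t'" by blast
  from step_tm[OF w(1) sx] have tw: "tm w \<rho>" .
  \<comment> \<open>The reduct \<open>w\<close> of the opened body is closed again over
    \<open>x\<close>; opening this with \<open>x\<close> gives back \<open>w\<close>.\<close>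
  let ?s' = "bind_var 0 x w"
  have "tm (Abs \<tau> ?s') \<sigma>"
    using tw typed_bind_var[of "[]" w \<rho> "[]" "[]" x \<tau>] 3(1) \<rho>(1) by (auto simp: tm_def intro: typed.intros)
  moreover have "rewr R (Abs \<tau> s) (Abs \<tau> ?s')"
    using w(1) 3(1,4) by (intro rewr.intros(5)[of x]) (auto simp: step_def)
  moreover have "Abs \<tau> ?s' \<unrhd> t'"
    using w(2) 3(1) strict_subterm_subterm.intros(3)[of x \<tau> ?s' t'] subterm_iff by simp
  ultimately show ?case using 3(5) unfolding step_def by blast
next
  case (4 s\<^sub>1 t s\<^sub>2)
  then show ?case
    by (meson tm_App step_App1 strict_subterm_subterm.intros)
next
  case (5 s\<^sub>2 t s\<^sub>1)
  then show ?case
    by (meson tm_App step_App2 strict_subterm_subterm.intros)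
qed (auto intro: strict_subterm_subterm.intros)

text \<open>Lexicographic argument with \<open>s\<close> as surrounding term: a rewrite step of
  \<open>u\<close> is matched by one of \<open>s\<close>, which decreases in the outer induction; a
  subterm step keeps \<open>s\<close> and decreases the size of \<open>u\<close>.\<close>

lemma SN_step_subterm_tm:
  assumes "SN (step R) s" "tm s \<sigma>" "s \<unrhd> u"
  shows "SN (\<lambda>a b. step R a b \<or> a \<rhd> b) u"
  using assms
proof (induction arbitrary: u rule: SN_induct)
  case (step s)
  from step(4) show ?case
  proof (induction u rule: measure_induct_rule[of size])
    case (less u)
    show ?case
    proof (rule SN_I)
      fix v assume "step R u v \<or> u \<rhd> v"
      then show "SN (\<lambda>a b. step R a b \<or> a \<rhd> b) v"
      proof
        assume "step R u v"
        then obtain s' where "step R s s'" "s' \<unrhd> v"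
          using subterm_step(2)[OF less.prems step(3)] by blast
        then show ?thesis using step(2) step_tm step(3) by blast
      next
        assume "u \<rhd> v"
        then show ?thesis
          using less subterm_size(1) subterm_trans(2) subterm_iff by blast
      qed
    qed
  qed
qed

text \<open>Serves the minimal flag, where no type of the projected term is at hand. If
  \<open>s\<close> is not a well-typed term, \<open>step R\<close> cannot apply to it, so only
  subterm steps remain and induction on the size works.\<close>

lemma SN_step_subterm:
  assumes "\<And>u. s \<unrhd> u \<Longrightarrow> SN (step R) u"
  shows "SN (\<lambda>a b. step R a b \<or> a \<rhd> b) s"
  using assms
proof (induction s rule: measure_induct_rule[of size])
  case (less s)
  show ?case
  proof (cases "\<exists>\<sigma>. tm s \<sigma>")
    case True
    then show ?thesis using SN_step_subterm_tm less.prems subterm_refl by blast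
  next
    case False
    show ?thesis
    proof (rule SN_I)
      fix v assume "step R s v \<or> s \<rhd> v"
      with False have "s \<rhd> v" by (auto simp: step_def)
      then show "SN (\<lambda>a b. step R a b \<or> a \<rhd> b) v"
        using less subterm_size(1) subterm_trans(2) subterm_iff by blast
    qed
  qed
qed

section \<open>Computable terms are terminating\<close>

text \<open>This is why a term headed by a variable is never an instance of a left-hand
  side.\<close>

lemma rule_instance_hd: "rules U \<Longrightarrow> (l, r) \<in> U \<Longrightarrow> \<exists>f. hd_of (msubst \<delta> l) = Fun f"
  by (fastforce simp: is_rule_def msubst_apps hd_of_apps)

lemma rewr_App_Var:
  assumes "rewr U (App u t) w" "rules U" "hd_of u = Var x"
  shows "(\<exists>u'. rewr U u u' \<and> w = App u' t) \<or> (\<exists>t'. rewr U t t' \<and> w = App u t')"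
  using assms(1)
proof (cases rule: rewr.cases)
  case (1 l r \<delta>)
  from rule_instance_hd[OF assms(2) 1(3), of \<delta>] 1(1) assms(3) show ?thesis
    by (metis hd_of.simps(1) mterm.distinct(11))
qed (use assms(3) in auto)

lemma rewr_hd_Var:
  assumes "rewr U u w" "rules U" "hd_of u = Var x"
  shows "hd_of w = Var x"
  using assms(1,3)
proof (induction rule: rewr.induct)
  case (1 l r \<delta>)
  with rule_instance_hd[OF assms(2) 1(1), of \<delta>] show ?case by auto
qed auto

text \<open>With a variable as head no redex arises at the root, now or later, so every step happens
  in \<open>u\<close> or in \<open>t\<close>, and nested induction on both applies.\<close>

lemma SN_App_Var:
  assumes "SN (step U) u" "SN (step U) t" "rules U" "hd_of u = Var x"
  shows "SN (step U) (App u t)"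
  using assms(1,2,4)
proof (induction arbitrary: t rule: SN_induct)
  case (step u)
  note outer = step
  from step(3) show ?case
  proof (induction rule: SN_induct)
    case (step t)
    show ?case
    proof (rule SN_I)
      fix w assume w: "step U (App u t) w"
      then obtain \<tau> where \<tau>: "tm (App u t) \<tau>" "tm w \<tau>" "rewr U (App u t) w"
        by (auto simp: step_def)
      from tm_App[OF \<tau>(1)] obtain \<sigma> where \<sigma>: "tm u (\<sigma> \<rightarrow>\<^sub>t \<tau>)" "tm t \<sigma>" by blast
      from rewr_App_Var[OF \<tau>(3) assms(3) outer(4)] show "SN (step U) w"
      proof (elim disjE exE conjE)
        fix u' assume u': "rewr U u u'" "w = App u' t"
        \<comment> \<open>\<open>rewr\<close> carries no types; the type of \<open>u'\<close> is
          recovered from that of \<open>t\<close>, as types are unique.\<close>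
        from tm_App[of u' t \<tau>] u' \<tau>(2) \<sigma> tm_unique have "tm u' (\<sigma> \<rightarrow>\<^sub>t \<tau>)" by blast
        with u' \<sigma> have "step U u u'" by (auto simp: step_def)
        with outer(2) step(1) u' rewr_hd_Var[OF u'(1) assms(3) outer(4)] show ?thesis by blast
      next
        fix t' assume t': "rewr U t t'" "w = App u t'"
        from tm_App[of u t' \<tau>] t' \<tau>(2) \<sigma> tm_unique have "tm t' \<sigma>" by blast
        with t' \<sigma> have "step U t t'" by (auto simp: step_def)
        with step(2) t' show ?thesis by blast
      qed
    qed
  qed
qed

lemma SN_step_App1: "SN (step U) (App s t) \<Longrightarrow> tm (App s t) \<tau> \<Longrightarrow> SN (step U) s"
proof (induction "App s t" arbitrary: s rule: SN_induct)
  case step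
  show ?case
  proof (rule SN_I)
    fix s' assume "step U s s'"
    then have "step U (App s t) (App s' t)" using step by (rule_tac step_App1)
    then show "SN (step U) s'" using step step_tm by blast
  qed
qed

text \<open>The usual reducibility argument, with both claims in one induction on the type. At an
  arrow type, the first claim applies \<open>s\<close> to a variable, computable by the second claim
  for the argument type; the second needs that computable arguments terminate.\<close>

lemma comp_at_SN:
  assumes U: "rules U" and I: "RC_set U I"
  shows "(\<forall>s. comp_at I \<sigma> s \<longrightarrow> SN (step U) s) \<and>
         (\<forall>u x. hd_of u = Var x \<longrightarrow> tm u \<sigma> \<longrightarrow> SN (step U) u \<longrightarrow> comp_at I \<sigma> u)"
proof (induction \<sigma>)
  case (Base \<kappa>)
  have "u \<in> I" if "SN (step U) u" "hd_of u = Var x" "tm u (Base \<kappa>)" for u x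
    using that
  proof (induction rule: SN_induct)
    case (step u)
    have red: "t \<in> I" if t: "step U u t" for t
    proof (rule step(2)[OF t])
      show "hd_of t = Var x"
        using t step(3) by (auto simp: step_def intro: rewr_hd_Var[OF _ U])
      show "tm t (Base \<kappa>)" using t step(4) by (rule step_tm)
    qed
    \<comment> \<open>Brings \<open>u\<close> into the form \<open>apps (Var x) ss\<close>, for
      which an RC-set only asks that all reducts lie in it.\<close>
    have "apps (hd_of v) (args_of v) = v" for v :: "('f, 'v, 'm, 's) mterm"
      by (induction v) auto
    from this[of u] have u: "apps (Var x) (args_of u) = u" unfolding step(3) .
    from I have "base_tm (apps (Var x) ss) \<and> (\<forall>t. step U (apps (Var x) ss) t \<longrightarrow> t \<in> I)
        \<longrightarrow> apps (Var x) ss \<in> I" for ss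
      unfolding RC_set_def by blast
    from this[of "args_of u", unfolded u] red step(4) show ?case unfolding base_tm_def by blast
  qed
  moreover have "SN (step U) s" if "s \<in> I" for s using I that unfolding RC_set_def by blast
  ultimately show ?case unfolding comp_at.simps by blast
next
  case (Arr \<sigma> \<tau>)
  have "SN (step U) s" if s: "comp_at I (\<sigma> \<rightarrow>\<^sub>t \<tau>) s" for s
  proof -
    \<comment> \<open>Some variable of type \<open>\<sigma>\<close> exists; it is a normal form and
      hence terminating.\<close>
    from inf_vars[of \<sigma>] obtain x where x: "vty x = \<sigma>" using not_finite_existsD by fastforce
    then have tx: "tm (Var x) \<sigma>" using typed.intros(2)[of "[]" x] by (simp add: tm_def)
    have "\<not> rewr U (Var x) t" for t
    proof
      assume "rewr U (Var x) t"
      then show False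
      proof (cases rule: rewr.cases)
        case (1 l r \<delta>)
        from rule_instance_hd[OF U 1(3), of \<delta>] 1(1) show False
          by (metis hd_of.simps(3) mterm.distinct(11))
      qed
    qed
    then have "SN (step U) (Var x)" using SN_I[of "step U" "Var x"] by (auto simp: step_def)
    with Arr.IH(1) tx have "comp_at I \<sigma> (Var x)" by simp
    with s have c: "comp_at I \<tau> (App s (Var x))" by simp
    with Arr.IH(2) have "SN (step U) (App s (Var x))" by blast
    then show ?thesis by (rule SN_step_App1[OF _ comp_at_tm[OF c]])
  qed
  moreover have "comp_at I (\<sigma> \<rightarrow>\<^sub>t \<tau>) u"
    if u: "hd_of u = Var x" "tm u (\<sigma> \<rightarrow>\<^sub>t \<tau>)" "SN (step U) u" for u x
  proof -
    have "comp_at I \<tau> (App u t)" if t: "comp_at I \<sigma> t" for t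
    proof -
      have "SN (step U) t" using Arr.IH(1) t by blast
      then have "SN (step U) (App u t)" by (rule SN_App_Var[OF u(3) _ U u(1)])
      moreover have "tm (App u t) \<tau>" by (rule tm_AppI[OF u(2) comp_at_tm[OF t]])
      moreover have "hd_of (App u t) = Var x" using u(1) by simp
      ultimately show ?thesis using Arr.IH(2) by blast
    qed
    with u(2) show ?thesis by simp
  qed
  ultimately show ?case by blast
qed

lemma computable_SN: "rules U \<Longrightarrow> computable (C_of U) s \<Longrightarrow> SN (step U) s"
  using comp_at_SN[of U "C_of U"] C_of_spec[of U] unfolding computable_def by blast

section \<open>The subterm criterion\<close>

lemma chain_projection_SN:
  assumes chain: "inf_chain P R d s t g" and P: "\<forall>d\<in>P. is_dp d" and \<nu>: "projection_function P \<nu>"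
    and m: "mflag_ge m Minimal" and U: "\<forall>U. m = Computable U \<longrightarrow> rules U"
    and comp: "\<forall>U. m = Computable U \<longrightarrow> computable_chain U R d g"
    and min: "m = Minimal \<longrightarrow> minimal_chain R t"
  shows "SN (\<lambda>a b. step R a b \<or> a \<rhd> b) (nu_bar \<nu> (t 0))"
proof -
  obtain l p A where d: "d 0 = (l, p, A)" by (cases "d 0")
  then have dP: "(l, p, A) \<in> P" and t: "t 0 = msubst (g 0) p"
    using chain[unfolded inf_chain_def, THEN spec, of 0] by auto
  from P dP obtain f ps where p: "p = apps (Fun f) ps" and "FV p = {}"
    by (fastforce simp: is_dp_def closed_meta_term_def)
  from \<nu> dP have def: "nu_bar_defined \<nu> p" by (auto simp: projection_function_def)
  then have mem: "nu_bar \<nu> p \<in> set ps" unfolding p by (rule nu_bar_mem)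
  then have cl: "FV (nu_bar \<nu> p) = {}" using \<open>FV p = {}\<close> by (auto simp: p FV_apps)
  have nt: "nu_bar \<nu> (t 0) = msubst (g 0) (nu_bar \<nu> p)"
    unfolding t p by (rule nu_bar_msubst) (use def p in simp)
  show ?thesis
  proof (cases m)
    case Minimal
    have "t 0 \<rhd> u" if "nu_bar \<nu> (t 0) \<unrhd> u" for u
      using mem that unfolding nt unfolding t p msubst_apps
      by (intro apps_strict_subterm[of "msubst (g 0) (nu_bar \<nu> p)"]) (auto simp: p)
    with min Minimal have "SN (step R) u" if "nu_bar \<nu> (t 0) \<unrhd> u" for u
      using that unfolding minimal_chain_def by blast
    then show ?thesis by (rule SN_step_subterm)
  next
    case Arbitrary
    \<comment> \<open>No generating pair of the flag order starts in \<open>Arbitrary\<close>, so it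
      is not above \<open>Minimal\<close>.\<close>
    from m have "m \<noteq> Arbitrary"
      by (cases rule: converse_rtranclpE) (auto elim: mflag_gen.cases)
    with Arbitrary show ?thesis by contradiction
  next
    case (Computable V)
    with comp have cc: "computable_chain V R d g" by blast
    \<comment> \<open>An argument below a function symbol is reached with the empty set of
      conditions, which every substitution respects. Being closed, it gets an empty
      \<lambda>-prefix.\<close>
    have "beta_sub {} p (nu_bar \<nu> p)" unfolding p
      by (rule beta_sub.intros(5)[OF mem[unfolded p]]) (rule beta_sub.intros(1))
    moreover have "resp (g 0) {}" by (simp add: resp_def)
    ultimately have "computable (C_of V) (msubst (g 0) (lambdas [] (nu_bar \<nu> p)))"
      using cc[unfolded computable_chain_def, THEN conjunct2, THEN spec, of 0,
          unfolded d prod.case, THEN spec, THEN spec, THEN spec, of "{}" "nu_bar \<nu> p" "[]"] cl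
      by simp
    then have c: "computable (C_of V) (nu_bar \<nu> (t 0))" by (simp add: lambdas_def nt)
    have "rules V" using U Computable by simp
    from computable_SN[OF this c] have "SN (step V) (nu_bar \<nu> (t 0))" .
    then have "SN (step R) (nu_bar \<nu> (t 0))"
      by (rule SN_mono) (use cc in \<open>auto simp: computable_chain_def\<close>)
    moreover from c obtain \<sigma> where "tm (nu_bar \<nu> (t 0)) \<sigma>"
      by (auto simp: computable_def dest: comp_at_tm)
    ultimately show ?thesis using subterm_refl by (rule SN_step_subterm_tm)
  qed
qed

text \<open>The witness \<open>b\<close> is the projection of \<open>s (Suc i)\<close>, an instance
  of the projected left-hand side under the same substitution that instantiates the right-hand
  side.\<close>

lemma chain_projection_step:
  assumes chain: "inf_chain P R d s t g" and P: "\<forall>d\<in>P. is_dp d" and \<nu>: "projection_function P \<nu>"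
    and d: "d (Suc i) = (l, p, A)"
  shows "\<exists>b. (step R)\<^sup>*\<^sup>* (nu_bar \<nu> (t i)) b \<and>
     (nu_bar \<nu> l \<rhd> nu_bar \<nu> p \<longrightarrow> b \<rhd> nu_bar \<nu> (t (Suc i))) \<and>
     (nu_bar \<nu> l = nu_bar \<nu> p \<longrightarrow> b = nu_bar \<nu> (t (Suc i)))"
proof -
  let ?\<gamma> = "g (Suc i)"
  note c = chain[unfolded inf_chain_def, THEN spec]
  from c[of "Suc i"] d have dP: "(l, p, A) \<in> P" and sub: "is_sub ?\<gamma>"
    and dom: "dom ?\<gamma> = FMV l \<union> FMV p" and s: "s (Suc i) = msubst ?\<gamma> l"
    and t: "t (Suc i) = msubst ?\<gamma> p" by auto
  from P dP obtain f ls h ps where l: "l = apps (Fun f) ls" "FV l = {}"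
    and p: "p = apps (Fun h) ps" "FV p = {}"
    by (fastforce simp: is_dp_def closed_meta_term_def)
  from \<nu> dP have def: "nu_bar_defined \<nu> l" "nu_bar_defined \<nu> p"
    by (auto simp: projection_function_def)
  have ns: "nu_bar \<nu> (s (Suc i)) = msubst ?\<gamma> (nu_bar \<nu> l)"
    unfolding s l(1) by (rule nu_bar_msubst) (use def l in simp)
  have nt: "nu_bar \<nu> (t (Suc i)) = msubst ?\<gamma> (nu_bar \<nu> p)"
    unfolding t p(1) by (rule nu_bar_msubst) (use def p in simp)
  have "nu_bar \<nu> l \<in> set ls" "nu_bar \<nu> p \<in> set ps"
    using def unfolding l(1) p(1) by (auto intro: nu_bar_mem)
  \<comment> \<open>The projections are arguments of closed meta-terms with no binder in between,
    hence closed themselves; this makes the subterm relation stable under the substitution.\<close>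
  then have cl: "FV (nu_bar \<nu> l) = {}" "FV (nu_bar \<nu> p) = {}"
    using l p by (auto simp: FV_apps)
  from c[of i] obtain k us ws where uw: "t i = apps (Fun k) us" "s (Suc i) = apps (Fun k) ws"
    "list_all2 (step R)\<^sup>*\<^sup>* us ws" by blast
  \<comment> \<open>Comparing heads and argument lists shows that \<open>t i\<close> and
    \<open>s (Suc i)\<close> are projected to the same, existing position.\<close>
  have eq: "apps (Fun k) ws = apps (Fun f) (map (msubst ?\<gamma>) ls)"
    using uw(2) s by (simp add: l(1) msubst_apps)
  have "k = f" using arg_cong[OF eq, of hd_of] by simp
  moreover have "length ws = length ls" using arg_cong[OF eq, of args_of] by simp
  ultimately have "\<nu> k - 1 < length us"
    using def(1) list_all2_lengthD[OF uw(3)] by (auto simp: l(1) nu_bar_defined_apps)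
  then have "(step R)\<^sup>*\<^sup>* (nu_bar \<nu> (t i)) (nu_bar \<nu> (s (Suc i)))"
    unfolding uw(1,2) nu_bar_apps using list_all2_nthD[OF uw(3)] by blast
  moreover have "msubst ?\<gamma> (nu_bar \<nu> l) \<rhd> msubst ?\<gamma> (nu_bar \<nu> p)" if "nu_bar \<nu> l \<rhd> nu_bar \<nu> p"
    using strict_subterm_msubst[OF sub _ that cl] dom by (simp add: finite_FMV)
  ultimately show ?thesis using ns nt by auto
qed

text \<open>The conditions on a chain only relate neighbouring positions. As \<open>Q\<close> is
  free, this covers both the tail over \<open>P\<^sub>2\<close> and, with \<open>n = 0\<close>, the
  enlargement of the set of pairs.\<close>

lemma inf_chain_shift:
  assumes "inf_chain P R d s t g" "\<And>i. d (i + n) \<in> Q"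
  shows "inf_chain Q R (\<lambda>i. d (i + n)) (\<lambda>i. s (i + n)) (\<lambda>i. t (i + n)) (\<lambda>i. g (i + n))"
  unfolding inf_chain_def add_Suc
  by (rule allI, rule conjI[OF assms(2)],
      rule conjunct2[OF spec[OF assms(1)[unfolded inf_chain_def]]])

lemma computable_chain_shift:
  assumes "computable_chain U R d g"
  shows "computable_chain U R (\<lambda>i. d (i + n)) (\<lambda>i. g (i + n))"
  unfolding computable_chain_def
  by (rule conjI[OF conjunct1[OF assms[unfolded computable_chain_def]]], rule allI,
      rule spec[OF conjunct2[OF assms[unfolded computable_chain_def]]])

lemma subcrit_finite:
  assumes M: "is_dpp M" and sc: "subcrit M M'" and fin: "finite_dpp M'"
  shows "finite_dpp M"
proof -
  from sc obtain P\<^sub>1 P\<^sub>2 R m f \<nu> where Me: "M = (P\<^sub>1 \<union> P\<^sub>2, R, m, f)" and mge: "mflag_ge m Minimal"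
    and \<nu>: "projection_function (P\<^sub>1 \<union> P\<^sub>2) \<nu>"
    and P1: "\<And>l p A. (l, p, A) \<in> P\<^sub>1 \<Longrightarrow> nu_bar \<nu> l \<rhd> nu_bar \<nu> p"
    and P2: "\<And>l p A. (l, p, A) \<in> P\<^sub>2 \<Longrightarrow> nu_bar \<nu> l = nu_bar \<nu> p"
    and M': "M' = (P\<^sub>2, R, m, f)"
    unfolding subcrit_def by fast
  from M have dps: "\<forall>d\<in>P\<^sub>1 \<union> P\<^sub>2. is_dp d" and U: "\<forall>U. m = Computable U \<longrightarrow> rules U"
    by (auto simp: is_dpp_def Me)
  have False if chain: "inf_chain (P\<^sub>1 \<union> P\<^sub>2) R d s t g"
    and comp: "\<forall>U. m = Computable U \<longrightarrow> computable_chain U R d g"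
    and min: "m = Minimal \<longrightarrow> minimal_chain R t"
    and form: "f = Formative \<longrightarrow> formative_chain R d t g" for d s t g
  proof -
    let ?r = "\<lambda>a b. step R a b \<or> a \<rhd> b" and ?a = "\<lambda>i. nu_bar \<nu> (t i)"
    have dP: "d i \<in> P\<^sub>1 \<union> P\<^sub>2" for i using chain unfolding inf_chain_def by blast
    have star: "?r\<^sup>*\<^sup>* a b" if "(step R)\<^sup>*\<^sup>* a b" for a b
      using that by (rule rtranclp_mono[THEN predicate2D, rotated]) auto
    have steps: "?r\<^sup>*\<^sup>* (?a i) (?a (Suc i))"
      and strict: "d (Suc i) \<in> P\<^sub>1 \<Longrightarrow> ?r\<^sup>+\<^sup>+ (?a i) (?a (Suc i))" for i
    proof -
      obtain l p A where d: "d (Suc i) = (l, p, A)" by (cases "d (Suc i)")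
      from chain_projection_step[OF chain dps \<nu> d] obtain b
        where b: "?r\<^sup>*\<^sup>* (?a i) b" "nu_bar \<nu> l \<rhd> nu_bar \<nu> p \<longrightarrow> b \<rhd> ?a (Suc i)"
          "nu_bar \<nu> l = nu_bar \<nu> p \<longrightarrow> b = ?a (Suc i)" using star by blast
      show strict: "?r\<^sup>+\<^sup>+ (?a i) (?a (Suc i))" if "d (Suc i) \<in> P\<^sub>1"
        by (rule rtranclp_into_tranclp1[OF b(1)]) (use that d P1 b(2) in auto)
      show "?r\<^sup>*\<^sup>* (?a i) (?a (Suc i))"
      proof (cases "d (Suc i) \<in> P\<^sub>1")
        case True
        then show ?thesis by (rule tranclp_into_rtranclp[OF strict])
      next
        case False
        \<comment> \<open>A pair outside \<open>P\<^sub>1\<close> lies in \<open>P\<^sub>2\<close>,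
          so the projected term changes by rewriting only.\<close>
        then have "nu_bar \<nu> l = nu_bar \<nu> p" using dP[of "Suc i"] d P2[of l p A] by auto
        with b show ?thesis by simp
      qed
    qed
    have "SN ?r (?a 0)"
      by (rule chain_projection_SN[OF chain dps \<nu> mge U comp min])
    from SN_eventually_not_tranclp[of ?r ?a, OF this steps] strict obtain N
      where N: "\<And>i. i \<ge> N \<Longrightarrow> d (Suc i) \<notin> P\<^sub>1" by blast
    \<comment> \<open>The transition from \<open>i\<close> uses the pair at \<open>Suc i\<close>, so
      the bound \<open>N\<close> on transitions controls the pairs from \<open>Suc N\<close>
      on.\<close>
    let ?sh = "\<lambda>h i. h (i + Suc N)"
    have "d (i + Suc N) \<in> P\<^sub>2" for i using N[of "i + N"] dP[of "i + Suc N"] by auto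
    with chain have "inf_chain P\<^sub>2 R (?sh d) (?sh s) (?sh t) (?sh g)" by (rule inf_chain_shift)
    moreover have "\<forall>U. m = Computable U \<longrightarrow> computable_chain U R (?sh d) (?sh g)"
      using comp computable_chain_shift[of _ R d g "Suc N"] by simp
    moreover have "m = Minimal \<longrightarrow> minimal_chain R (?sh t)"
      using min by (simp add: minimal_chain_def)
    moreover have "f = Formative \<longrightarrow> formative_chain R (?sh d) (?sh t) (?sh g)"
      using form by (simp add: formative_chain_def)
    ultimately have "\<exists>d s t g. inf_chain P\<^sub>2 R d s t g \<and>
        (\<forall>U. m = Computable U \<longrightarrow> computable_chain U R d g) \<and>
        (m = Minimal \<longrightarrow> minimal_chain R t) \<and> (f = Formative \<longrightarrow> formative_chain R d t g)"
      by (intro exI conjI)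
    with fin show False unfolding finite_dpp_def M' prod.case by contradiction
  qed
  then show ?thesis unfolding finite_dpp_def Me prod.case by blast
qed

text \<open>The rules stay the same and a chain over \<open>P\<^sub>2\<close> is also one over the
  larger set, so either witness of infinity carries over.\<close>

lemma subcrit_infinite:
  assumes "subcrit M M'" "infinite_dpp M'"
  shows "infinite_dpp M"
proof -
  from assms(1) obtain P\<^sub>1 P\<^sub>2 R m f where M: "M = (P\<^sub>1 \<union> P\<^sub>2, R, m, f)" "M' = (P\<^sub>2, R, m, f)"
    unfolding subcrit_def by blast
  have "inf_chain (P\<^sub>1 \<union> P\<^sub>2) R d s t g" if "inf_chain P\<^sub>2 R d s t g" for d s t g
    using inf_chain_shift[OF that, of 0 "P\<^sub>1 \<union> P\<^sub>2"] that by (auto simp: inf_chain_def)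
  with assms(2) show ?thesis unfolding infinite_dpp_def M prod.case by blast
qed

end

theorem theorem61:
  fixes fty :: "'f \<Rightarrow> 's ty" and vty :: "'v \<Rightarrow> 's ty" and mty :: "'m \<Rightarrow> 's ty"
    and arity :: "'m \<Rightarrow> nat" and sort_ge :: "'s \<Rightarrow> 's \<Rightarrow> bool"
    and Proc :: "('f, 'v, 'm, 's) dpp \<Rightarrow> ('f, 'v, 'm, 's) answer"
  assumes "static_dp vty mty arity sort_ge"
    and "static_dp.subcrit_processor fty vty mty arity Proc"
  shows "static_dp.sound fty vty mty arity sort_ge Proc \<and>
         static_dp.complete fty vty mty arity Proc"
proof -
  interpret static_dp fty vty mty arity sort_ge by (fact assms(1))
  \<comment> \<open>The answer is never \<open>NO\<close> but always a singleton, so both properties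
    reduce to a comparison of \<open>M\<close> with that one problem.\<close>
  have Proc: "\<exists>M'. Proc M = Problems {M'} \<and> (M' = M \<or> subcrit M M')" if "is_dpp M" for M
    using assms(2) that unfolding subcrit_processor_def by metis
  show ?thesis
    unfolding sound_def complete_def
    using Proc subcrit_finite subcrit_infinite by fastforce
qed

end
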